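(* Let $R$ be a commutative ring, $L$ an $R$-Lie algebra, and let $(M\xrightarrow{\mu}L,\psi_M)$ and $(N\xrightarrow{\nu}L,\psi_N)$ be crossed modules of $R$-Lie algebras over $L$. Let $M\bowtie N$ be the Peiffer product of $M$ and $N$ with respect to the induced actions ${}^{m}n:=\psi_N(\mu(m),n)$ and ${}^{n}m:=\psi_M(\nu(n),m)$. Then the crossed module $(M\bowtie N\xrightarrow{\overline{(\mu,\nu)}}L,\psi_{M\bowtie N})$, with coprojections given by $l_M\colon M\to M\bowtie N$ and $l_N\colon N\to M\bowtie N$, is the coproduct of $(M\xrightarrow{\mu}L,\psi_M)$ and $(N\xrightarrow{\nu}L,\psi_N)$ in the category $\mathbf{XMod}_L(\mathbf{Lie}_R)$ of crossed modules of $R$-Lie algebras over $L$.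
   Context: An $R$-Lie algebra is an $R$-module with an $R$-bilinear bracket satisfying $[x,x]=0$ and the Jacobi identity. $M+N$ denotes the coproduct of $M$ and $N$ in the category $\mathbf{Lie}_R$ of $R$-Lie algebras; $M$ and $N$ are identified with their images in $M+N$. An action of an $R$-Lie algebra $P$ on an $R$-Lie algebra $M$ is an $R$-bilinear map $\psi\colon P\times M\to M$, $(p,m)\mapsto {}^{p}m$, such that ${}^{[p,p']}m={}^{p}({}^{p'}m)-{}^{p'}({}^{p}m)$ and ${}^{p}[m,m']=[{}^{p}m,m']+[m,{}^{p}m']$. A crossed module of $R$-Lie algebras $(M\xrightarrow{\partial}P,\psi)$ consists of a Lie algebra morphism $\partial\colon M\to P$ and an action $\psi$ of $P$ on $M$ such that ${}^{\partial(m)}m'=[m,m']$ and $\partial({}^{p}m)=[p,\partial(m)]$ for all $m,m'\in M$, $p\in P$. The objects of $\mathbf{XMod}_L(\mathbf{Lie}_R)$ are the crossed modules with codomain $L$; a morphism from $(M\xrightarrow{\mu}L,\psi_M)$ to $(Z\xrightarrow{z}L,\psi_Z)$ is a Lie algebra morphism $f\colon M\to Z$ with $z\circ f=\mu$ and $f({}^{l}m)={}^{l}f(m)$ for all $l\in L$, $m\in M$. Peiffer product: given an action of $M$ on $N$ and an action of $N$ on $M$, let $K$ be the ideal of $M+N$ generated by the elements ${}^{n}m-[n,m]$ and ${}^{m}n-[m,n]$ for $m\in M$, $n\in N$; then $M\bowtie N:=(M+N)/K$ with quotient map $q\colon M+N\to M\bowtie N$. The maps $l_M$ and $l_N$ are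 the composites of the coproduct inclusions $M\to M+N$, $N\to M+N$ with $q$. Action of $L$: the actions of $L$ on $M$ and $N$ extend uniquely to an action $\psi_{M+N}$ of $L$ on $M+N$, determined by linearity and by ${}^{l}[s_1,s_2]=[{}^{l}s_1,s_2]+[s_1,{}^{l}s_2]$. This action maps $K$ into $K$, and $\psi_{M\bowtie N}$ is the induced action of $L$ on $M\bowtie N$: ${}^{l}q(s)=q({}^{l}s)$. The morphism $\overline{(\mu,\nu)}\colon M\bowtie N\to L$ is the unique Lie algebra morphism with $\overline{(\mu,\nu)}\circ l_M=\mu$ and $\overline{(\mu,\nu)}\circ l_N=\nu$. *)

theory Defs
  imports "HOL-Algebra.Module" "HOL-Algebra.AbelCoset" "HOL-Library.FuncSet"
begin

section \<open>Lie algebras over a commutative ring\<close>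

text \<open>
  As everywhere in HOL-Algebra, module records carry the fields \<open>mult\<close> and \<open>one\<close> inherited from
  rings; no axiom below mentions them, and the constructions leave them unspecified.
\<close>

record ('r, 'a) lie_algebra = "('r, 'a) module" +
  lbracket :: "'a \<Rightarrow> 'a \<Rightarrow> 'a"

locale lie_algebra = module R L for R (structure) and L (structure) +
  assumes lbracket_closed:
      "\<lbrakk>x \<in> carrier L; y \<in> carrier L\<rbrakk> \<Longrightarrow> lbracket L x y \<in> carrier L"
    and lbracket_add_left:
      "\<lbrakk>x \<in> carrier L; y \<in> carrier L; z \<in> carrier L\<rbrakk> \<Longrightarrow>
        lbracket L (x \<oplus>\<^bsub>L\<^esub> y) z = lbracket L x z \<oplus>\<^bsub>L\<^esub> lbracket L y z"
    and lbracket_add_right: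
      "\<lbrakk>x \<in> carrier L; y \<in> carrier L; z \<in> carrier L\<rbrakk> \<Longrightarrow>
        lbracket L x (y \<oplus>\<^bsub>L\<^esub> z) = lbracket L x y \<oplus>\<^bsub>L\<^esub> lbracket L x z"
    and lbracket_smult_left:
      "\<lbrakk>a \<in> carrier R; x \<in> carrier L; y \<in> carrier L\<rbrakk> \<Longrightarrow>
        lbracket L (a \<odot>\<^bsub>L\<^esub> x) y = a \<odot>\<^bsub>L\<^esub> lbracket L x y"
    and lbracket_smult_right:
      "\<lbrakk>a \<in> carrier R; x \<in> carrier L; y \<in> carrier L\<rbrakk> \<Longrightarrow>
        lbracket L x (a \<odot>\<^bsub>L\<^esub> y) = a \<odot>\<^bsub>L\<^esub> lbracket L x y"
    and lbracket_self:
      "x \<in> carrier L \<Longrightarrow> lbracket L x x = \<zero>\<^bsub>L\<^esub>"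
    and jacobi:
      "\<lbrakk>x \<in> carrier L; y \<in> carrier L; z \<in> carrier L\<rbrakk> \<Longrightarrow>
        lbracket L x (lbracket L y z) \<oplus>\<^bsub>L\<^esub> (lbracket L y (lbracket L z x) \<oplus>\<^bsub>L\<^esub>
          lbracket L z (lbracket L x y)) = \<zero>\<^bsub>L\<^esub>"

definition lie_hom ::
  "('r, 'k) ring_scheme \<Rightarrow> ('r, 'a) lie_algebra \<Rightarrow> ('r, 'b) lie_algebra \<Rightarrow> ('a \<Rightarrow> 'b) set"
  where "lie_hom R A B = {f. f \<in> carrier A \<rightarrow> carrier B \<and>
    (\<forall>x\<in>carrier A. \<forall>y\<in>carrier A. f (x \<oplus>\<^bsub>A\<^esub> y) = f x \<oplus>\<^bsub>B\<^esub> f y) \<and>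
    (\<forall>a\<in>carrier R. \<forall>x\<in>carrier A. f (a \<odot>\<^bsub>A\<^esub> x) = a \<odot>\<^bsub>B\<^esub> f x) \<and>
    (\<forall>x\<in>carrier A. \<forall>y\<in>carrier A. f (lbracket A x y) = lbracket B (f x) (f y))}"

definition lie_ideal :: "('r, 'k) ring_scheme \<Rightarrow> ('r, 'a) lie_algebra \<Rightarrow> 'a set \<Rightarrow> bool"
  where "lie_ideal R A I \<longleftrightarrow> submodule I R A \<and>
    (\<forall>x\<in>carrier A. \<forall>y\<in>I. lbracket A x y \<in> I)"

definition lie_ideal_gen :: "('r, 'k) ring_scheme \<Rightarrow> ('r, 'a) lie_algebra \<Rightarrow> 'a set \<Rightarrow> 'a set"
  where "lie_ideal_gen R A S = \<Inter> {I. lie_ideal R A I \<and> S \<subseteq> I}"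

definition lie_quotient :: "('r, 'a) lie_algebra \<Rightarrow> 'a set \<Rightarrow> ('r, 'a set) lie_algebra"
  where "lie_quotient A I = \<lparr>carrier = a_rcosets\<^bsub>A\<^esub> I, mult = undefined, one = undefined,
    zero = I, add = set_add A,
    smult = (\<lambda>a X. \<Union>x\<in>X. I +>\<^bsub>A\<^esub> (a \<odot>\<^bsub>A\<^esub> x)),
    lbracket = (\<lambda>X Y. \<Union>x\<in>X. \<Union>y\<in>Y. I +>\<^bsub>A\<^esub> lbracket A x y)\<rparr>"


section \<open>The coproduct of two Lie algebras\<close>

text \<open>
  The coproduct is realised as the algebra of formal Lie expressions in the elements of \<open>M\<close> and
  \<open>N\<close>, modulo the congruence generated by the axioms of Lie algebras and by the requirement that
  the two inclusions of generators be morphisms. Its universal property is proved below.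
\<close>

datatype ('r, 'm, 'n) lie_term =
    Left 'm
  | Right 'n
  | TZero
  | TAdd "('r, 'm, 'n) lie_term" "('r, 'm, 'n) lie_term"
  | TSmult 'r "('r, 'm, 'n) lie_term"
  | TBracket "('r, 'm, 'n) lie_term" "('r, 'm, 'n) lie_term"

inductive_set lie_terms ::
  "('r, 'k) ring_scheme \<Rightarrow> ('r, 'm) lie_algebra \<Rightarrow> ('r, 'n) lie_algebra \<Rightarrow> ('r, 'm, 'n) lie_term set"
  for R M N where
  "m \<in> carrier M \<Longrightarrow> Left m \<in> lie_terms R M N"
| "n \<in> carrier N \<Longrightarrow> Right n \<in> lie_terms R M N"
| "TZero \<in> lie_terms R M N"
| "\<lbrakk>s \<in> lie_terms R M N; t \<in> lie_terms R M N\<rbrakk> \<Longrightarrow> TAdd s t \<in> lie_terms R M N"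
| "\<lbrakk>a \<in> carrier R; t \<in> lie_terms R M N\<rbrakk> \<Longrightarrow> TSmult a t \<in> lie_terms R M N"
| "\<lbrakk>s \<in> lie_terms R M N; t \<in> lie_terms R M N\<rbrakk> \<Longrightarrow> TBracket s t \<in> lie_terms R M N"

inductive lie_term_eq ::
  "('r, 'k) ring_scheme \<Rightarrow> ('r, 'm) lie_algebra \<Rightarrow> ('r, 'n) lie_algebra \<Rightarrow>
    ('r, 'm, 'n) lie_term \<Rightarrow> ('r, 'm, 'n) lie_term \<Rightarrow> bool"
  for R M N where
  te_refl: "t \<in> lie_terms R M N \<Longrightarrow> lie_term_eq R M N t t"
| te_sym: "lie_term_eq R M N s t \<Longrightarrow> lie_term_eq R M N t s"
| te_trans: "\<lbrakk>lie_term_eq R M N s t; lie_term_eq R M N t u\<rbrakk> \<Longrightarrow> lie_term_eq R M N s u"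
| te_add: "\<lbrakk>lie_term_eq R M N s s'; lie_term_eq R M N t t'\<rbrakk> \<Longrightarrow>
    lie_term_eq R M N (TAdd s t) (TAdd s' t')"
| te_smult: "\<lbrakk>a \<in> carrier R; lie_term_eq R M N t t'\<rbrakk> \<Longrightarrow>
    lie_term_eq R M N (TSmult a t) (TSmult a t')"
| te_bracket: "\<lbrakk>lie_term_eq R M N s s'; lie_term_eq R M N t t'\<rbrakk> \<Longrightarrow>
    lie_term_eq R M N (TBracket s t) (TBracket s' t')"
| te_add_assoc: "\<lbrakk>s \<in> lie_terms R M N; t \<in> lie_terms R M N; u \<in> lie_terms R M N\<rbrakk> \<Longrightarrow>
    lie_term_eq R M N (TAdd (TAdd s t) u) (TAdd s (TAdd t u))"
| te_add_comm: "\<lbrakk>s \<in> lie_terms R M N; t \<in> lie_terms R M N\<rbrakk> \<Longrightarrow>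
    lie_term_eq R M N (TAdd s t) (TAdd t s)"
| te_zero: "t \<in> lie_terms R M N \<Longrightarrow> lie_term_eq R M N (TAdd TZero t) t"
| te_neg: "t \<in> lie_terms R M N \<Longrightarrow>
    lie_term_eq R M N (TAdd (TSmult (\<ominus>\<^bsub>R\<^esub> \<one>\<^bsub>R\<^esub>) t) t) TZero"
| te_smult_l_distr: "\<lbrakk>a \<in> carrier R; b \<in> carrier R; t \<in> lie_terms R M N\<rbrakk> \<Longrightarrow>
    lie_term_eq R M N (TSmult (a \<oplus>\<^bsub>R\<^esub> b) t) (TAdd (TSmult a t) (TSmult b t))"
| te_smult_r_distr: "\<lbrakk>a \<in> carrier R; s \<in> lie_terms R M N; t \<in> lie_terms R M N\<rbrakk> \<Longrightarrow>
    lie_term_eq R M N (TSmult a (TAdd s t)) (TAdd (TSmult a s) (TSmult a t))"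
| te_smult_assoc: "\<lbrakk>a \<in> carrier R; b \<in> carrier R; t \<in> lie_terms R M N\<rbrakk> \<Longrightarrow>
    lie_term_eq R M N (TSmult (a \<otimes>\<^bsub>R\<^esub> b) t) (TSmult a (TSmult b t))"
| te_smult_one: "t \<in> lie_terms R M N \<Longrightarrow> lie_term_eq R M N (TSmult \<one>\<^bsub>R\<^esub> t) t"
| te_bracket_add_left: "\<lbrakk>s \<in> lie_terms R M N; t \<in> lie_terms R M N; u \<in> lie_terms R M N\<rbrakk> \<Longrightarrow>
    lie_term_eq R M N (TBracket (TAdd s t) u) (TAdd (TBracket s u) (TBracket t u))"
| te_bracket_add_right: "\<lbrakk>s \<in> lie_terms R M N; t \<in> lie_terms R M N; u \<in> lie_terms R M N\<rbrakk> \<Longrightarrow>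
    lie_term_eq R M N (TBracket s (TAdd t u)) (TAdd (TBracket s t) (TBracket s u))"
| te_bracket_smult_left: "\<lbrakk>a \<in> carrier R; s \<in> lie_terms R M N; t \<in> lie_terms R M N\<rbrakk> \<Longrightarrow>
    lie_term_eq R M N (TBracket (TSmult a s) t) (TSmult a (TBracket s t))"
| te_bracket_smult_right: "\<lbrakk>a \<in> carrier R; s \<in> lie_terms R M N; t \<in> lie_terms R M N\<rbrakk> \<Longrightarrow>
    lie_term_eq R M N (TBracket s (TSmult a t)) (TSmult a (TBracket s t))"
| te_bracket_self: "t \<in> lie_terms R M N \<Longrightarrow> lie_term_eq R M N (TBracket t t) TZero"
| te_jacobi: "\<lbrakk>s \<in> lie_terms R M N; t \<in> lie_terms R M N; u \<in> lie_terms R M N\<rbrakk> \<Longrightarrow>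
    lie_term_eq R M N (TAdd (TBracket s (TBracket t u))
      (TAdd (TBracket t (TBracket u s)) (TBracket u (TBracket s t)))) TZero"
| te_left_add: "\<lbrakk>m \<in> carrier M; m' \<in> carrier M\<rbrakk> \<Longrightarrow>
    lie_term_eq R M N (Left (m \<oplus>\<^bsub>M\<^esub> m')) (TAdd (Left m) (Left m'))"
| te_left_smult: "\<lbrakk>a \<in> carrier R; m \<in> carrier M\<rbrakk> \<Longrightarrow>
    lie_term_eq R M N (Left (a \<odot>\<^bsub>M\<^esub> m)) (TSmult a (Left m))"
| te_left_bracket: "\<lbrakk>m \<in> carrier M; m' \<in> carrier M\<rbrakk> \<Longrightarrow>
    lie_term_eq R M N (Left (lbracket M m m')) (TBracket (Left m) (Left m'))"
| te_right_add: "\<lbrakk>n \<in> carrier N; n' \<in> carrier N\<rbrakk> \<Longrightarrow>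
    lie_term_eq R M N (Right (n \<oplus>\<^bsub>N\<^esub> n')) (TAdd (Right n) (Right n'))"
| te_right_smult: "\<lbrakk>a \<in> carrier R; n \<in> carrier N\<rbrakk> \<Longrightarrow>
    lie_term_eq R M N (Right (a \<odot>\<^bsub>N\<^esub> n)) (TSmult a (Right n))"
| te_right_bracket: "\<lbrakk>n \<in> carrier N; n' \<in> carrier N\<rbrakk> \<Longrightarrow>
    lie_term_eq R M N (Right (lbracket N n n')) (TBracket (Right n) (Right n'))"

definition lie_term_class ::
  "('r, 'k) ring_scheme \<Rightarrow> ('r, 'm) lie_algebra \<Rightarrow> ('r, 'n) lie_algebra \<Rightarrow>
    ('r, 'm, 'n) lie_term \<Rightarrow> ('r, 'm, 'n) lie_term set"
  where "lie_term_class R M N t = {s. lie_term_eq R M N t s}"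

definition lie_coprod ::
  "('r, 'k) ring_scheme \<Rightarrow> ('r, 'm) lie_algebra \<Rightarrow> ('r, 'n) lie_algebra \<Rightarrow>
    ('r, ('r, 'm, 'n) lie_term set) lie_algebra"
  where "lie_coprod R M N = \<lparr>carrier = lie_term_class R M N ` lie_terms R M N,
    mult = undefined, one = undefined,
    zero = lie_term_class R M N TZero,
    add = (\<lambda>X Y. \<Union>s\<in>X. \<Union>t\<in>Y. lie_term_class R M N (TAdd s t)),
    smult = (\<lambda>a X. \<Union>t\<in>X. lie_term_class R M N (TSmult a t)),
    lbracket = (\<lambda>X Y. \<Union>s\<in>X. \<Union>t\<in>Y. lie_term_class R M N (TBracket s t))\<rparr>"

definition coprod_inl ::
  "('r, 'k) ring_scheme \<Rightarrow> ('r, 'm) lie_algebra \<Rightarrow> ('r, 'n) lie_algebra \<Rightarrow>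
    'm \<Rightarrow> ('r, 'm, 'n) lie_term set"
  where "coprod_inl R M N m = lie_term_class R M N (Left m)"

definition coprod_inr ::
  "('r, 'k) ring_scheme \<Rightarrow> ('r, 'm) lie_algebra \<Rightarrow> ('r, 'n) lie_algebra \<Rightarrow>
    'n \<Rightarrow> ('r, 'm, 'n) lie_term set"
  where "coprod_inr R M N n = lie_term_class R M N (Right n)"

lemma lie_term_class_eq:
  "lie_term_eq R M N s t \<Longrightarrow> lie_term_class R M N s = lie_term_class R M N t"
  unfolding lie_term_class_def by (blast intro: te_sym te_trans)

lemma lie_term_class_eq_iff:
  "t \<in> lie_terms R M N \<Longrightarrow>
    lie_term_class R M N s = lie_term_class R M N t \<longleftrightarrow> lie_term_eq R M N s t"
  using lie_term_class_eq unfolding lie_term_class_def by (blast intro: te_refl)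

lemma UN_class_eq:
  assumes "t \<in> lie_terms R M N"
    and "\<And>t'. lie_term_eq R M N t t' \<Longrightarrow> F t' = F t"
  shows "(\<Union>t'\<in>lie_term_class R M N t. F t') = F t"
  using assms te_refl[OF assms(1)] unfolding lie_term_class_def by blast

lemma lie_coprod_carrier:
  "carrier (lie_coprod R M N) = lie_term_class R M N ` lie_terms R M N"
  by (simp add: lie_coprod_def)

lemma lie_coprod_zero: "\<zero>\<^bsub>lie_coprod R M N\<^esub> = lie_term_class R M N TZero"
  by (simp add: lie_coprod_def)

lemma lie_coprod_add:
  assumes "s \<in> lie_terms R M N" "t \<in> lie_terms R M N"
  shows "lie_term_class R M N s \<oplus>\<^bsub>lie_coprod R M N\<^esub> lie_term_class R M N t =
    lie_term_class R M N (TAdd s t)"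
proof -
  have "(\<Union>t'\<in>lie_term_class R M N t. lie_term_class R M N (TAdd s' t')) =
      lie_term_class R M N (TAdd s t)" if "lie_term_eq R M N s s'" for s'
    by (subst UN_class_eq[OF assms(2)])
      (use that assms in \<open>auto intro!: lie_term_class_eq intro: te_add te_sym te_refl te_trans\<close>)
  then show ?thesis
    using te_refl[OF assms(1)] by (auto simp: lie_coprod_def lie_term_class_def[of _ _ _ s])
qed

lemma lie_coprod_bracket:
  assumes "s \<in> lie_terms R M N" "t \<in> lie_terms R M N"
  shows "lbracket (lie_coprod R M N) (lie_term_class R M N s) (lie_term_class R M N t) =
    lie_term_class R M N (TBracket s t)"
proof -
  have "(\<Union>t'\<in>lie_term_class R M N t. lie_term_class R M N (TBracket s' t')) =
      lie_term_class R M N (TBracket s t)" if "lie_term_eq R M N s s'" for s'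
    by (subst UN_class_eq[OF assms(2)])
      (use that assms in \<open>auto intro!: lie_term_class_eq intro: te_bracket te_sym te_refl te_trans\<close>)
  then show ?thesis
    using te_refl[OF assms(1)] by (auto simp: lie_coprod_def lie_term_class_def[of _ _ _ s])
qed

lemma lie_coprod_smult:
  assumes "a \<in> carrier R" "t \<in> lie_terms R M N"
  shows "a \<odot>\<^bsub>lie_coprod R M N\<^esub> lie_term_class R M N t = lie_term_class R M N (TSmult a t)"
proof -
  have "(\<Union>t'\<in>lie_term_class R M N t. lie_term_class R M N (TSmult a t')) =
      lie_term_class R M N (TSmult a t)"
    by (rule UN_class_eq[OF assms(2)]) (rule lie_term_class_eq[OF te_smult[OF assms(1) te_sym]])
  then show ?thesis
    by (simp add: lie_coprod_def)
qed

lemmas lie_coprod_simps =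
  lie_coprod_carrier lie_coprod_zero lie_coprod_add lie_coprod_bracket lie_coprod_smult

lemma lie_coprod_lie_algebra:
  assumes "cring R"
  shows "lie_algebra R (lie_coprod R M N)"
proof -
  interpret R: cring R by fact
  note [simp] = lie_coprod_simps lie_terms.intros
  have "abelian_group (lie_coprod R M N)"
  proof (rule abelian_groupI)
    fix x assume "x \<in> carrier (lie_coprod R M N)"
    then obtain t where "t \<in> lie_terms R M N" "x = lie_term_class R M N t"
      by auto
    then show "\<exists>y\<in>carrier (lie_coprod R M N).
        y \<oplus>\<^bsub>lie_coprod R M N\<^esub> x = \<zero>\<^bsub>lie_coprod R M N\<^esub>"
      by (intro bexI[of _ "lie_term_class R M N (TSmult (\<ominus>\<^bsub>R\<^esub> \<one>\<^bsub>R\<^esub>) t)"])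
        (auto intro!: lie_term_class_eq te_neg)
  qed (auto intro!: lie_term_class_eq te_add_assoc te_add_comm te_zero del: equalityI)
  then have "module R (lie_coprod R M N)"
    by (intro moduleI assms) (auto intro!: lie_term_class_eq
        te_smult_l_distr te_smult_r_distr te_smult_assoc te_smult_one del: equalityI)
  then show ?thesis
    by (intro lie_algebra.intro lie_algebra_axioms.intro) (auto intro!: lie_term_class_eq
        te_bracket_add_left te_bracket_add_right te_bracket_smult_left te_bracket_smult_right
        te_bracket_self te_jacobi del: equalityI)
qed

lemma coprod_inl_hom: "coprod_inl R M N \<in> lie_hom R M (lie_coprod R M N)"
  by (auto simp: lie_hom_def coprod_inl_def lie_coprod_simps lie_terms.intros
      intro!: lie_term_class_eq te_left_add te_left_smult te_left_bracket del: equalityI)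

lemma coprod_inr_hom: "coprod_inr R M N \<in> lie_hom R N (lie_coprod R M N)"
  by (auto simp: lie_hom_def coprod_inr_def lie_coprod_simps lie_terms.intros
      intro!: lie_term_class_eq te_right_add te_right_smult te_right_bracket del: equalityI)

primrec lie_eval ::
  "('r, 'z) lie_algebra \<Rightarrow> ('m \<Rightarrow> 'z) \<Rightarrow> ('n \<Rightarrow> 'z) \<Rightarrow> ('r, 'm, 'n) lie_term \<Rightarrow> 'z" where
  "lie_eval Z f g (Left m) = f m"
| "lie_eval Z f g (Right n) = g n"
| "lie_eval Z f g TZero = \<zero>\<^bsub>Z\<^esub>"
| "lie_eval Z f g (TAdd s t) = lie_eval Z f g s \<oplus>\<^bsub>Z\<^esub> lie_eval Z f g t"
| "lie_eval Z f g (TSmult a t) = a \<odot>\<^bsub>Z\<^esub> lie_eval Z f g t"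
| "lie_eval Z f g (TBracket s t) = lbracket Z (lie_eval Z f g s) (lie_eval Z f g t)"

lemma lie_eval_closed:
  assumes "lie_algebra R Z" "f \<in> lie_hom R M Z" "g \<in> lie_hom R N Z" "t \<in> lie_terms R M N"
  shows "lie_eval Z f g t \<in> carrier Z"
proof -
  interpret Z: lie_algebra R Z by fact
  from assms(4) show ?thesis
    by induction (use assms(2,3) in \<open>auto simp: lie_hom_def intro: Z.lbracket_closed\<close>)
qed

lemma lie_eval_cong:
  assumes "lie_algebra R Z" "f \<in> lie_hom R M Z" "g \<in> lie_hom R N Z" "lie_term_eq R M N s t"
  shows "lie_eval Z f g s = lie_eval Z f g t"
proof -
  interpret Z: lie_algebra R Z by fact
  note [simp] = lie_eval_closed[OF assms(1-3)]
  note hom = assms(2,3)[unfolded lie_hom_def]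
  from assms(4) show ?thesis
  proof induction
    case (te_neg t)
    then show ?case by (simp add: Z.smult_l_minus Z.M.l_neg)
  next
    case (te_add_assoc s t u)
    then show ?case by (simp add: Z.M.a_assoc)
  next
    case (te_add_comm s t)
    then show ?case by (simp add: Z.M.a_comm)
  next
    case (te_smult_l_distr a b t)
    then show ?case by (simp add: Z.smult_l_distr)
  next
    case (te_smult_r_distr a s t)
    then show ?case by (simp add: Z.smult_r_distr)
  next
    case (te_smult_assoc a b t)
    then show ?case by (simp add: Z.smult_assoc1)
  next
    case (te_bracket_add_left s t u)
    then show ?case by (simp add: Z.lbracket_add_left)
  next
    case (te_bracket_add_right s t u)
    then show ?case by (simp add: Z.lbracket_add_right)
  next
    case (te_bracket_smult_left a s t)
    then show ?case by (simp add: Z.lbracket_smult_left)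
  next
    case (te_bracket_smult_right a s t)
    then show ?case by (simp add: Z.lbracket_smult_right)
  next
    case (te_bracket_self t)
    then show ?case by (simp add: Z.lbracket_self)
  next
    case (te_jacobi s t u)
    then show ?case by (simp add: Z.jacobi)
  qed (use hom in simp_all)
qed

theorem lie_coprod_universal:
  assumes "lie_algebra R Z" "f \<in> lie_hom R M Z" "g \<in> lie_hom R N Z"
  shows "\<exists>!h. h \<in> lie_hom R (lie_coprod R M N) Z \<and> h \<in> extensional (carrier (lie_coprod R M N)) \<and>
    (\<forall>m\<in>carrier M. h (coprod_inl R M N m) = f m) \<and>
    (\<forall>n\<in>carrier N. h (coprod_inr R M N n) = g n)"
proof -
  interpret Z: lie_algebra R Z by fact
  interpret S: lie_algebra R "lie_coprod R M N"
    by (rule lie_coprod_lie_algebra) (rule module.axioms(1)[OF lie_algebra.axioms(1)[OF assms(1)]])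
  define h where "h = (\<lambda>X\<in>carrier (lie_coprod R M N). lie_eval Z f g (SOME t. t \<in> lie_terms R M N \<and>
    X = lie_term_class R M N t))"
  have h: "h (lie_term_class R M N t) = lie_eval Z f g t" if t: "t \<in> lie_terms R M N" for t
  proof -
    let ?u = "SOME u. u \<in> lie_terms R M N \<and> lie_term_class R M N t = lie_term_class R M N u"
    have u: "?u \<in> lie_terms R M N \<and> lie_term_class R M N t = lie_term_class R M N ?u"
      by (rule someI[of _ t]) (use t in simp)
    have "lie_term_eq R M N t ?u"
      by (rule iffD1[OF lie_term_class_eq_iff[OF conjunct1[OF u]] conjunct2[OF u]])
    from lie_eval_cong[OF assms this] show ?thesis
      using t by (simp add: h_def lie_coprod_carrier)
  qed
  show ?thesis
  proof (rule ex1I[of _ h], intro conjI)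
    show "h \<in> lie_hom R (lie_coprod R M N) Z"
      unfolding lie_hom_def
      by (auto simp: lie_coprod_simps lie_terms.intros h lie_eval_closed[OF assms])
    show "h \<in> extensional (carrier (lie_coprod R M N))"
      by (simp add: h_def)
    show "\<forall>m\<in>carrier M. h (coprod_inl R M N m) = f m"
      and "\<forall>n\<in>carrier N. h (coprod_inr R M N n) = g n"
      by (simp_all add: coprod_inl_def coprod_inr_def h lie_terms.intros)
  next
    fix k assume k: "k \<in> lie_hom R (lie_coprod R M N) Z \<and>
      k \<in> extensional (carrier (lie_coprod R M N)) \<and>
      (\<forall>m\<in>carrier M. k (coprod_inl R M N m) = f m) \<and>
      (\<forall>n\<in>carrier N. k (coprod_inr R M N n) = g n)"
    have z: "k \<zero>\<^bsub>lie_coprod R M N\<^esub> = \<zero>\<^bsub>Z\<^esub>"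
    proof -
      have "k (\<zero>\<^bsub>R\<^esub> \<odot>\<^bsub>lie_coprod R M N\<^esub> \<zero>\<^bsub>lie_coprod R M N\<^esub>) = \<zero>\<^bsub>R\<^esub> \<odot>\<^bsub>Z\<^esub> k \<zero>\<^bsub>lie_coprod R M N\<^esub>"
        using k unfolding lie_hom_def by blast
      moreover have "k \<zero>\<^bsub>lie_coprod R M N\<^esub> \<in> carrier Z"
        using k unfolding lie_hom_def by blast
      ultimately show ?thesis by simp
    qed
    have "k (lie_term_class R M N t) = lie_eval Z f g t" if "t \<in> lie_terms R M N" for t
      using that
    proof induction
      case 3
      then show ?case using z by (simp add: lie_coprod_zero)
    next
      case (4 s t)
      then have "k (lie_term_class R M N s \<oplus>\<^bsub>lie_coprod R M N\<^esub> lie_term_class R M N t) =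
          k (lie_term_class R M N s) \<oplus>\<^bsub>Z\<^esub> k (lie_term_class R M N t)"
        using k unfolding lie_hom_def lie_coprod_carrier by blast
      then show ?case using 4 by (simp add: lie_coprod_add)
    next
      case (5 a t)
      then have "k (a \<odot>\<^bsub>lie_coprod R M N\<^esub> lie_term_class R M N t) =
          a \<odot>\<^bsub>Z\<^esub> k (lie_term_class R M N t)"
        using k unfolding lie_hom_def lie_coprod_carrier by blast
      then show ?case using 5 by (simp add: lie_coprod_smult)
    next
      case (6 s t)
      then have "k (lbracket (lie_coprod R M N) (lie_term_class R M N s) (lie_term_class R M N t)) =
          lbracket Z (k (lie_term_class R M N s)) (k (lie_term_class R M N t))"
        using k unfolding lie_hom_def lie_coprod_carrier by blast
      then show ?case using 6 by (simp add: lie_coprod_bracket)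
    qed (use k in \<open>simp_all add: coprod_inl_def coprod_inr_def\<close>)
    then have "k X = h X" if "X \<in> carrier (lie_coprod R M N)" for X
      using that h unfolding lie_coprod_carrier by fastforce
    moreover have "h \<in> extensional (carrier (lie_coprod R M N))"
      by (simp add: h_def)
    ultimately show "k = h"
      using k by (blast intro: extensionalityI)
  qed
qed

section \<open>Actions and crossed modules\<close>

definition lie_action ::
  "('r, 'k) ring_scheme \<Rightarrow> ('r, 'p) lie_algebra \<Rightarrow> ('r, 'a) lie_algebra \<Rightarrow>
    ('p \<Rightarrow> 'a \<Rightarrow> 'a) \<Rightarrow> bool"
  where "lie_action R P A \<psi> \<longleftrightarrow>
    (\<forall>p\<in>carrier P. \<forall>m\<in>carrier A. \<psi> p m \<in> carrier A) \<and>
    (\<forall>p\<in>carrier P. \<forall>p'\<in>carrier P. \<forall>m\<in>carrier A. \<psi> (p \<oplus>\<^bsub>P\<^esub> p') m = \<psi> p m \<oplus>\<^bsub>A\<^esub> \<psi> p' m) \<and>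
    (\<forall>a\<in>carrier R. \<forall>p\<in>carrier P. \<forall>m\<in>carrier A. \<psi> (a \<odot>\<^bsub>P\<^esub> p) m = a \<odot>\<^bsub>A\<^esub> \<psi> p m) \<and>
    (\<forall>p\<in>carrier P. \<forall>m\<in>carrier A. \<forall>m'\<in>carrier A. \<psi> p (m \<oplus>\<^bsub>A\<^esub> m') = \<psi> p m \<oplus>\<^bsub>A\<^esub> \<psi> p m') \<and>
    (\<forall>p\<in>carrier P. \<forall>a\<in>carrier R. \<forall>m\<in>carrier A. \<psi> p (a \<odot>\<^bsub>A\<^esub> m) = a \<odot>\<^bsub>A\<^esub> \<psi> p m) \<and>
    (\<forall>p\<in>carrier P. \<forall>p'\<in>carrier P. \<forall>m\<in>carrier A.
      \<psi> (lbracket P p p') m = \<psi> p (\<psi> p' m) \<ominus>\<^bsub>A\<^esub> \<psi> p' (\<psi> p m)) \<and>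
    (\<forall>p\<in>carrier P. \<forall>m\<in>carrier A. \<forall>m'\<in>carrier A.
      \<psi> p (lbracket A m m') = lbracket A (\<psi> p m) m' \<oplus>\<^bsub>A\<^esub> lbracket A m (\<psi> p m'))"

text \<open>The data of a crossed module whose codomain (kept separate) has elements of type \<open>'l\<close>.\<close>

record ('r, 'l, 'm) xmod =
  src :: "('r, 'm) lie_algebra"
  bdry :: "'m \<Rightarrow> 'l"
  act :: "'l \<Rightarrow> 'm \<Rightarrow> 'm"

definition crossed_module ::
  "('r, 'k) ring_scheme \<Rightarrow> ('r, 'l) lie_algebra \<Rightarrow> ('r, 'l, 'm) xmod \<Rightarrow> bool"
  where "crossed_module R L X \<longleftrightarrow>
    lie_algebra R L \<and> lie_algebra R (src X) \<and>
    bdry X \<in> lie_hom R (src X) L \<and> lie_action R L (src X) (act X) \<and>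
    (\<forall>m\<in>carrier (src X). \<forall>m'\<in>carrier (src X). act X (bdry X m) m' = lbracket (src X) m m') \<and>
    (\<forall>p\<in>carrier L. \<forall>m\<in>carrier (src X). bdry X (act X p m) = lbracket L p (bdry X m))"

definition xmod_hom ::
  "('r, 'k) ring_scheme \<Rightarrow> ('r, 'l) lie_algebra \<Rightarrow> ('r, 'l, 'm) xmod \<Rightarrow> ('r, 'l, 'z) xmod \<Rightarrow>
    ('m \<Rightarrow> 'z) set"
  where "xmod_hom R L X Z = {f \<in> lie_hom R (src X) (src Z).
    (\<forall>m\<in>carrier (src X). bdry Z (f m) = bdry X m) \<and>
    (\<forall>l\<in>carrier L. \<forall>m\<in>carrier (src X). f (act X l m) = act Z l (f m))}"

text \<open>
  \<open>C\<close> with coprojections \<open>i\<close> and \<open>j\<close> is a coproduct of \<open>X\<close> and \<open>Y\<close> in the category of crossed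
  modules over \<open>L\<close>. The first argument is the type of elements of the test objects, over which HOL
  cannot quantify inside a formula; it is to be left as a free type variable. Functions
  are relevant on carriers only, whence the restriction to \<^const>\<open>extensional\<close> ones in the
  uniqueness part.
\<close>

definition xmod_coproduct ::
  "'z itself \<Rightarrow> ('r, 'k) ring_scheme \<Rightarrow> ('r, 'l) lie_algebra \<Rightarrow>
    ('r, 'l, 'm) xmod \<Rightarrow> ('r, 'l, 'n) xmod \<Rightarrow> ('r, 'l, 'c) xmod \<Rightarrow>
    ('m \<Rightarrow> 'c) \<Rightarrow> ('n \<Rightarrow> 'c) \<Rightarrow> bool"
  where "xmod_coproduct T R L X Y C i j \<longleftrightarrow>
    crossed_module R L C \<and> i \<in> xmod_hom R L X C \<and> j \<in> xmod_hom R L Y C \<and>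
    (\<forall>Z :: ('r, 'l, 'z) xmod. crossed_module R L Z \<longrightarrow>
      (\<forall>f\<in>xmod_hom R L X Z. \<forall>g\<in>xmod_hom R L Y Z.
        \<exists>!h. h \<in> xmod_hom R L C Z \<and> h \<in> extensional (carrier (src C)) \<and>
          (\<forall>m\<in>carrier (src X). h (i m) = f m) \<and>
          (\<forall>n\<in>carrier (src Y). h (j n) = g n)))"


section \<open>The Peiffer product\<close>

text \<open>Here \<open>\<alpha>\<close> is the action of \<open>M\<close> on \<open>N\<close> and \<open>\<beta>\<close> is the action of \<open>N\<close> on \<open>M\<close>.\<close>

definition peiffer_ideal ::
  "('r, 'k) ring_scheme \<Rightarrow> ('r, 'm) lie_algebra \<Rightarrow> ('r, 'n) lie_algebra \<Rightarrow>
    ('m \<Rightarrow> 'n \<Rightarrow> 'n) \<Rightarrow> ('n \<Rightarrow> 'm \<Rightarrow> 'm) \<Rightarrow> ('r, 'm, 'n) lie_term set set"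
  where "peiffer_ideal R M N \<alpha> \<beta> =
    (let S = lie_coprod R M N; i = coprod_inl R M N; j = coprod_inr R M N in
      lie_ideal_gen R S
        ({i (\<beta> n m) \<ominus>\<^bsub>S\<^esub> lbracket S (j n) (i m) | m n. m \<in> carrier M \<and> n \<in> carrier N} \<union>
         {j (\<alpha> m n) \<ominus>\<^bsub>S\<^esub> lbracket S (i m) (j n) | m n. m \<in> carrier M \<and> n \<in> carrier N}))"

definition peiffer_product ::
  "('r, 'k) ring_scheme \<Rightarrow> ('r, 'm) lie_algebra \<Rightarrow> ('r, 'n) lie_algebra \<Rightarrow>
    ('m \<Rightarrow> 'n \<Rightarrow> 'n) \<Rightarrow> ('n \<Rightarrow> 'm \<Rightarrow> 'm) \<Rightarrow> ('r, ('r, 'm, 'n) lie_term set set) lie_algebra"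
  where "peiffer_product R M N \<alpha> \<beta> =
    lie_quotient (lie_coprod R M N) (peiffer_ideal R M N \<alpha> \<beta>)"

definition peiffer_quot ::
  "('r, 'k) ring_scheme \<Rightarrow> ('r, 'm) lie_algebra \<Rightarrow> ('r, 'n) lie_algebra \<Rightarrow>
    ('m \<Rightarrow> 'n \<Rightarrow> 'n) \<Rightarrow> ('n \<Rightarrow> 'm \<Rightarrow> 'm) \<Rightarrow>
    ('r, 'm, 'n) lie_term set \<Rightarrow> ('r, 'm, 'n) lie_term set set"
  where "peiffer_quot R M N \<alpha> \<beta> s = peiffer_ideal R M N \<alpha> \<beta> +>\<^bsub>lie_coprod R M N\<^esub> s"

definition peiffer_inl ::
  "('r, 'k) ring_scheme \<Rightarrow> ('r, 'm) lie_algebra \<Rightarrow> ('r, 'n) lie_algebra \<Rightarrow>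
    ('m \<Rightarrow> 'n \<Rightarrow> 'n) \<Rightarrow> ('n \<Rightarrow> 'm \<Rightarrow> 'm) \<Rightarrow> 'm \<Rightarrow> ('r, 'm, 'n) lie_term set set"
  where "peiffer_inl R M N \<alpha> \<beta> = peiffer_quot R M N \<alpha> \<beta> \<circ> coprod_inl R M N"

definition peiffer_inr ::
  "('r, 'k) ring_scheme \<Rightarrow> ('r, 'm) lie_algebra \<Rightarrow> ('r, 'n) lie_algebra \<Rightarrow>
    ('m \<Rightarrow> 'n \<Rightarrow> 'n) \<Rightarrow> ('n \<Rightarrow> 'm \<Rightarrow> 'm) \<Rightarrow> 'n \<Rightarrow> ('r, 'm, 'n) lie_term set set"
  where "peiffer_inr R M N \<alpha> \<beta> = peiffer_quot R M N \<alpha> \<beta> \<circ> coprod_inr R M N"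

text \<open>The unique extension of two actions of \<open>L\<close> to an action on the coproduct.\<close>

definition coprod_action ::
  "('r, 'k) ring_scheme \<Rightarrow> ('r, 'l) lie_algebra \<Rightarrow> ('r, 'm) lie_algebra \<Rightarrow> ('r, 'n) lie_algebra \<Rightarrow>
    ('l \<Rightarrow> 'm \<Rightarrow> 'm) \<Rightarrow> ('l \<Rightarrow> 'n \<Rightarrow> 'n) \<Rightarrow>
    'l \<Rightarrow> ('r, 'm, 'n) lie_term set \<Rightarrow> ('r, 'm, 'n) lie_term set"
  where "coprod_action R L M N \<psi>\<^sub>M \<psi>\<^sub>N =
    (let S = lie_coprod R M N in
      THE \<Psi>. \<Psi> \<in> carrier L \<rightarrow>\<^sub>E (carrier S \<rightarrow>\<^sub>E carrier S) \<and> lie_action R L S \<Psi> \<and>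
        (\<forall>l\<in>carrier L. \<forall>m\<in>carrier M. \<Psi> l (coprod_inl R M N m) = coprod_inl R M N (\<psi>\<^sub>M l m)) \<and>
        (\<forall>l\<in>carrier L. \<forall>n\<in>carrier N. \<Psi> l (coprod_inr R M N n) = coprod_inr R M N (\<psi>\<^sub>N l n)))"

text \<open>
  The induced action on the quotient: all representatives \<open>s\<close> of a coset \<open>X\<close> give the same coset,
  so that the union is that coset (as in \<^const>\<open>lie_quotient\<close>).
\<close>

definition peiffer_action ::
  "('r, 'k) ring_scheme \<Rightarrow> ('r, 'l) lie_algebra \<Rightarrow> ('r, 'm) lie_algebra \<Rightarrow> ('r, 'n) lie_algebra \<Rightarrow>
    ('m \<Rightarrow> 'n \<Rightarrow> 'n) \<Rightarrow> ('n \<Rightarrow> 'm \<Rightarrow> 'm) \<Rightarrow> ('l \<Rightarrow> 'm \<Rightarrow> 'm) \<Rightarrow> ('l \<Rightarrow> 'n \<Rightarrow> 'n) \<Rightarrow>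
    'l \<Rightarrow> ('r, 'm, 'n) lie_term set set \<Rightarrow> ('r, 'm, 'n) lie_term set set"
  where "peiffer_action R L M N \<alpha> \<beta> \<psi>\<^sub>M \<psi>\<^sub>N l X =
    (\<Union>s\<in>X. peiffer_quot R M N \<alpha> \<beta> (coprod_action R L M N \<psi>\<^sub>M \<psi>\<^sub>N l s))"

definition peiffer_copair ::
  "('r, 'k) ring_scheme \<Rightarrow> ('r, 'l) lie_algebra \<Rightarrow> ('r, 'm) lie_algebra \<Rightarrow> ('r, 'n) lie_algebra \<Rightarrow>
    ('m \<Rightarrow> 'n \<Rightarrow> 'n) \<Rightarrow> ('n \<Rightarrow> 'm \<Rightarrow> 'm) \<Rightarrow> ('m \<Rightarrow> 'l) \<Rightarrow> ('n \<Rightarrow> 'l) \<Rightarrow>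
    ('r, 'm, 'n) lie_term set set \<Rightarrow> 'l"
  where "peiffer_copair R L M N \<alpha> \<beta> \<mu> \<nu> =
    (let P = peiffer_product R M N \<alpha> \<beta> in
      THE h. h \<in> lie_hom R P L \<and> h \<in> extensional (carrier P) \<and>
        (\<forall>m\<in>carrier M. h (peiffer_inl R M N \<alpha> \<beta> m) = \<mu> m) \<and>
        (\<forall>n\<in>carrier N. h (peiffer_inr R M N \<alpha> \<beta> n) = \<nu> n))"

end

theory Submission
  imports Defs
begin

text \<open>
  A morphism, or a derivation along a morphism, is determined by its values on generators of its
  domain. Derivations into an algebra are sections of its tangent algebra, so the universal property
  of \<open>M + N\<close> also extends derivations; this gives the action of \<open>L\<close> on \<open>M + N\<close>. Every axiom of a
  crossed module over \<open>L\<close>, and the equivariance of a morphism, is an equality of two derivations or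
  of two morphisms, hence has to be checked only on \<open>M\<close> and \<open>N\<close>: on \<open>M \<bowtie> N\<close> the Peiffer identity
  for mixed pairs is precisely what dividing by \<open>K\<close> enforces, and conversely the Peiffer identity of
  a test object forces the induced morphism out of \<open>M + N\<close> to kill \<open>K\<close>.
\<close>

section \<open>Computing in Lie algebras\<close>

text \<open>The action of \<open>L\<close> on \<open>M + N\<close> and the boundary map of the
  product are given by definite descriptions, so each needs existence as well as uniqueness. For the
  action, linearity in \<open>l\<close> and the bracket axiom require no further construction: sums,
  scalar multiples and commutators of derivations are derivations, so each axiom compares two
  extensions of the same data on \<open>M\<close> and \<open>N\<close>. The universal property of
  the Peiffer product is applied twice. With target \<open>L\<close> it yields the boundary map, and
  the relators vanish there because \<mu> and \<nu> are equivariant. With the source of a test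
  object as target it yields the induced morphism, and the relators vanish there by the Peiffer
  identity. Mathematically the first case is a special case of the second: \<open>L\<close> with the
  identity and its adjoint action is a crossed module, and \<mu>, \<nu> are morphisms into
  it.\<close>

context lie_algebra
begin

lemmas lie_simps = lbracket_closed lbracket_add_left lbracket_add_right
  lbracket_smult_left lbracket_smult_right lbracket_self

text \<open>Polarization: expanding \<open>[x + y, x + y] = 0\<close> leaves only the two mixed
  brackets. The argument is valid in every characteristic.\<close>

lemma lbracket_anticomm:
  assumes "x \<in> carrier L" "y \<in> carrier L"
  shows "lbracket L x y \<oplus>\<^bsub>L\<^esub> lbracket L y x = \<zero>\<^bsub>L\<^esub>"
proof -
  have "lbracket L x (x \<oplus>\<^bsub>L\<^esub> y) \<oplus>\<^bsub>L\<^esub> lbracket L y (x \<oplus>\<^bsub>L\<^esub> y) = \<zero>\<^bsub>L\<^esub>"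
    using assms by (metis M.a_closed lbracket_add_left lbracket_self)
  then show ?thesis
    using assms by (simp add: lie_simps M.a_comm)
qed

lemma lbracket_swap:
  assumes "x \<in> carrier L" "y \<in> carrier L"
  shows "lbracket L y x = \<ominus>\<^bsub>L\<^esub> lbracket L x y"
  using lbracket_anticomm[OF assms(2,1)] assms
  by (metis M.minus_equality lbracket_closed)

lemma lbracket_zero_left:
  assumes "x \<in> carrier L"
  shows "lbracket L \<zero>\<^bsub>L\<^esub> x = \<zero>\<^bsub>L\<^esub>"
  using lbracket_smult_left[of "\<zero>\<^bsub>R\<^esub>" "\<zero>\<^bsub>L\<^esub>" x] assms by (simp add: lbracket_closed)

lemma lbracket_zero_right:
  assumes "x \<in> carrier L"
  shows "lbracket L x \<zero>\<^bsub>L\<^esub> = \<zero>\<^bsub>L\<^esub>"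
  using lbracket_smult_right[of "\<zero>\<^bsub>R\<^esub>" x "\<zero>\<^bsub>L\<^esub>"] assms by (simp add: lbracket_closed)

lemma lbracket_minus_left:
  assumes "x \<in> carrier L" "y \<in> carrier L"
  shows "lbracket L (\<ominus>\<^bsub>L\<^esub> x) y = \<ominus>\<^bsub>L\<^esub> lbracket L x y"
  using lbracket_add_left[of "\<ominus>\<^bsub>L\<^esub> x" x y] assms
  by (simp add: M.l_neg lbracket_zero_left lbracket_closed M.minus_equality)

lemma lbracket_minus_right:
  assumes "x \<in> carrier L" "y \<in> carrier L"
  shows "lbracket L x (\<ominus>\<^bsub>L\<^esub> y) = \<ominus>\<^bsub>L\<^esub> lbracket L x y"
  using lbracket_add_right[of x "\<ominus>\<^bsub>L\<^esub> y" y] assms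
  by (simp add: M.l_neg lbracket_zero_right lbracket_closed M.minus_equality)

text \<open>The Jacobi identity as the Leibniz rule for \<open>ad x\<close>, the form behind
  \<open>ad_derivation\<close>.\<close>

lemma jacobi_right:
  assumes "x \<in> carrier L" "y \<in> carrier L" "z \<in> carrier L"
  shows "lbracket L x (lbracket L y z) =
    lbracket L (lbracket L x y) z \<oplus>\<^bsub>L\<^esub> lbracket L y (lbracket L x z)"
proof -
  have "lbracket L x (lbracket L y z) =
      \<ominus>\<^bsub>L\<^esub> (lbracket L y (lbracket L z x) \<oplus>\<^bsub>L\<^esub> lbracket L z (lbracket L x y))"
    using jacobi[OF assms] assms
    by (intro M.minus_equality[symmetric]) (simp_all add: lbracket_closed)
  also have "\<dots> = \<ominus>\<^bsub>L\<^esub> lbracket L z (lbracket L x y) \<oplus>\<^bsub>L\<^esub> \<ominus>\<^bsub>L\<^esub> lbracket L y (lbracket L z x)"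
    using assms by (simp add: lbracket_closed M.minus_add M.a_comm)
  also have "\<ominus>\<^bsub>L\<^esub> lbracket L z (lbracket L x y) = lbracket L (lbracket L x y) z"
    using assms by (metis lbracket_closed lbracket_swap)
  also have "\<ominus>\<^bsub>L\<^esub> lbracket L y (lbracket L z x) = lbracket L y (lbracket L x z)"
    using assms by (metis lbracket_closed lbracket_swap lbracket_minus_right)
  finally show ?thesis .
qed

text \<open>The same identity read in the other argument: \<open>ad\<close> turns brackets into
  commutators. This is the bracket axiom of an action, to be compared with that of \<psi> in
  \<open>crossed_moduleI_span\<close>.\<close>

lemma jacobi_left:
  assumes "x \<in> carrier L" "y \<in> carrier L" "z \<in> carrier L"
  shows "lbracket L (lbracket L x y) z =
    lbracket L x (lbracket L y z) \<ominus>\<^bsub>L\<^esub> lbracket L y (lbracket L x z)"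
  using assms
  by (simp add: jacobi_right[of x y z] lbracket_closed a_minus_def M.a_assoc M.r_neg)

end

section \<open>Morphisms and their values at zero, negatives and differences\<close>

lemma lie_homI:
  assumes "\<And>x. x \<in> carrier A \<Longrightarrow> f x \<in> carrier B"
    and "\<And>x y. \<lbrakk>x \<in> carrier A; y \<in> carrier A\<rbrakk> \<Longrightarrow> f (x \<oplus>\<^bsub>A\<^esub> y) = f x \<oplus>\<^bsub>B\<^esub> f y"
    and "\<And>a x. \<lbrakk>a \<in> carrier R; x \<in> carrier A\<rbrakk> \<Longrightarrow> f (a \<odot>\<^bsub>A\<^esub> x) = a \<odot>\<^bsub>B\<^esub> f x"
    and "\<And>x y. \<lbrakk>x \<in> carrier A; y \<in> carrier A\<rbrakk> \<Longrightarrow> f (lbracket A x y) = lbracket B (f x) (f y)"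
  shows "f \<in> lie_hom R A B"
  using assms by (simp add: lie_hom_def)

lemma lie_homD:
  assumes "f \<in> lie_hom R A B"
  shows "x \<in> carrier A \<Longrightarrow> f x \<in> carrier B"
    and "\<lbrakk>x \<in> carrier A; y \<in> carrier A\<rbrakk> \<Longrightarrow> f (x \<oplus>\<^bsub>A\<^esub> y) = f x \<oplus>\<^bsub>B\<^esub> f y"
    and "\<lbrakk>a \<in> carrier R; x \<in> carrier A\<rbrakk> \<Longrightarrow> f (a \<odot>\<^bsub>A\<^esub> x) = a \<odot>\<^bsub>B\<^esub> f x"
    and "\<lbrakk>x \<in> carrier A; y \<in> carrier A\<rbrakk> \<Longrightarrow> f (lbracket A x y) = lbracket B (f x) (f y)"
  using assms by (auto simp: lie_hom_def)

text \<open>Zero and negatives are scalar multiples by 0 and -1, so homogeneity settles both claims.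
  Stated for bare maps in order to serve morphisms and derivations alike.\<close>

lemma linear_map_zero_minus:
  assumes "module R A" "module R B"
    and "\<And>x. x \<in> carrier A \<Longrightarrow> f x \<in> carrier B"
    and "\<And>a x. \<lbrakk>a \<in> carrier R; x \<in> carrier A\<rbrakk> \<Longrightarrow> f (a \<odot>\<^bsub>A\<^esub> x) = a \<odot>\<^bsub>B\<^esub> f x"
  shows "f \<zero>\<^bsub>A\<^esub> = \<zero>\<^bsub>B\<^esub>" and "x \<in> carrier A \<Longrightarrow> f (\<ominus>\<^bsub>A\<^esub> x) = \<ominus>\<^bsub>B\<^esub> f x"
proof -
  interpret A: module R A by fact
  interpret B: module R B by fact
  show "f \<zero>\<^bsub>A\<^esub> = \<zero>\<^bsub>B\<^esub>"
    using assms(4)[of "\<zero>\<^bsub>R\<^esub>" "\<zero>\<^bsub>A\<^esub>"] assms(3)[of "\<zero>\<^bsub>A\<^esub>"] by simp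
  show "f (\<ominus>\<^bsub>A\<^esub> x) = \<ominus>\<^bsub>B\<^esub> f x" if "x \<in> carrier A"
    using assms(4)[of "\<ominus>\<^bsub>R\<^esub> \<one>\<^bsub>R\<^esub>" x] assms(3)[of x] that
    by (simp add: A.smult_l_minus B.smult_l_minus)
qed

lemma lie_hom_zero_minus:
  assumes "lie_algebra R A" "lie_algebra R B" "f \<in> lie_hom R A B"
  shows "f \<zero>\<^bsub>A\<^esub> = \<zero>\<^bsub>B\<^esub>"
    and "x \<in> carrier A \<Longrightarrow> f (\<ominus>\<^bsub>A\<^esub> x) = \<ominus>\<^bsub>B\<^esub> f x"
    and "\<lbrakk>x \<in> carrier A; y \<in> carrier A\<rbrakk> \<Longrightarrow> f (x \<ominus>\<^bsub>A\<^esub> y) = f x \<ominus>\<^bsub>B\<^esub> f y"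
proof -
  note m = linear_map_zero_minus[OF lie_algebra.axioms(1)[OF assms(1)] lie_algebra.axioms(1)[OF assms(2)],
      OF lie_homD(1,3)[OF assms(3)]]
  interpret A: lie_algebra R A by fact
  show "f \<zero>\<^bsub>A\<^esub> = \<zero>\<^bsub>B\<^esub>" by (rule m)
  show "x \<in> carrier A \<Longrightarrow> f (\<ominus>\<^bsub>A\<^esub> x) = \<ominus>\<^bsub>B\<^esub> f x" by (rule m)
  then show "\<lbrakk>x \<in> carrier A; y \<in> carrier A\<rbrakk> \<Longrightarrow> f (x \<ominus>\<^bsub>A\<^esub> y) = f x \<ominus>\<^bsub>B\<^esub> f y"
    using m(2)[of y] by (simp add: a_minus_def lie_homD(2)[OF assms(3)])
qed

lemma lie_hom_comp:
  assumes "f \<in> lie_hom R A B" "g \<in> lie_hom R B C"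
  shows "(\<lambda>x. g (f x)) \<in> lie_hom R A C"
  using lie_homD[OF assms(1)] lie_homD[OF assms(2)] by (intro lie_homI) simp_all

section \<open>Generation and derivations\<close>

text \<open>Negatives come from the scalar -1. The inductive form provides the induction by which
  equations are transported from generators to the whole algebra.\<close>

inductive_set lie_span :: "('r, 'k) ring_scheme \<Rightarrow> ('r, 'a) lie_algebra \<Rightarrow> 'a set \<Rightarrow> 'a set"
  for R A G where
  gen: "x \<in> G \<Longrightarrow> x \<in> lie_span R A G"
| zero: "\<zero>\<^bsub>A\<^esub> \<in> lie_span R A G"
| add: "\<lbrakk>x \<in> lie_span R A G; y \<in> lie_span R A G\<rbrakk> \<Longrightarrow> x \<oplus>\<^bsub>A\<^esub> y \<in> lie_span R A G"
| smult: "\<lbrakk>a \<in> carrier R; x \<in> lie_span R A G\<rbrakk> \<Longrightarrow> a \<odot>\<^bsub>A\<^esub> x \<in> lie_span R A G"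
| bracket: "\<lbrakk>x \<in> lie_span R A G; y \<in> lie_span R A G\<rbrakk> \<Longrightarrow> lbracket A x y \<in> lie_span R A G"

lemma lie_span_closed:
  assumes "lie_algebra R A" "G \<subseteq> carrier A" "x \<in> lie_span R A G"
  shows "x \<in> carrier A"
proof -
  interpret A: lie_algebra R A by fact
  from assms(3) show ?thesis
    by induction (use assms(2) in \<open>auto simp: A.lbracket_closed\<close>)
qed

lemma lie_hom_span:
  assumes "lie_algebra R A" "lie_algebra R B" "f \<in> lie_hom R A B" "G \<subseteq> carrier A" "x \<in> lie_span R A G"
  shows "f x \<in> lie_span R B (f ` G)"
proof -
  note closed = lie_span_closed[OF assms(1,4)]
  from assms(5) show ?thesis
    by induction (use closed in \<open>auto simp: lie_homD[OF assms(3)] lie_hom_zero_minus[OF assms(1-3)]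
        intro: lie_span.intros\<close>)
qed

lemma lie_hom_eq_on_span:
  assumes "lie_algebra R A" "lie_algebra R B" "f \<in> lie_hom R A B" "g \<in> lie_hom R A B"
    and "G \<subseteq> carrier A" "\<And>x. x \<in> G \<Longrightarrow> f x = g x" "x \<in> lie_span R A G"
  shows "f x = g x"
proof -
  note closed = lie_span_closed[OF assms(1,5)]
  from assms(7) show ?thesis
    by induction (use closed in \<open>auto simp: lie_homD[OF assms(3)] lie_homD[OF assms(4)]
        lie_hom_zero_minus[OF assms(1-3)] lie_hom_zero_minus[OF assms(1,2,4)] assms(6)\<close>)
qed

text \<open>When \<phi> is a morphism, these are the derivations of \<open>A\<close> with values in
  \<open>B\<close>, regarded as an \<open>A\<close>-module through \<phi>; the identity gives
  ordinary derivations. The relative notion is needed because equivariance of a morphism compares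
  maps between two different algebras.\<close>

definition lie_derivation ::
  "('r, 'k) ring_scheme \<Rightarrow> ('r, 'a) lie_algebra \<Rightarrow> ('r, 'b) lie_algebra \<Rightarrow> ('a \<Rightarrow> 'b) \<Rightarrow> ('a \<Rightarrow> 'b) set"
  where "lie_derivation R A B \<phi> = {d. d \<in> carrier A \<rightarrow> carrier B \<and>
    (\<forall>x\<in>carrier A. \<forall>y\<in>carrier A. d (x \<oplus>\<^bsub>A\<^esub> y) = d x \<oplus>\<^bsub>B\<^esub> d y) \<and>
    (\<forall>a\<in>carrier R. \<forall>x\<in>carrier A. d (a \<odot>\<^bsub>A\<^esub> x) = a \<odot>\<^bsub>B\<^esub> d x) \<and>
    (\<forall>x\<in>carrier A. \<forall>y\<in>carrier A.
      d (lbracket A x y) = lbracket B (d x) (\<phi> y) \<oplus>\<^bsub>B\<^esub> lbracket B (\<phi> x) (d y))}"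

lemma lie_derivationI:
  assumes "\<And>x. x \<in> carrier A \<Longrightarrow> d x \<in> carrier B"
    and "\<And>x y. \<lbrakk>x \<in> carrier A; y \<in> carrier A\<rbrakk> \<Longrightarrow> d (x \<oplus>\<^bsub>A\<^esub> y) = d x \<oplus>\<^bsub>B\<^esub> d y"
    and "\<And>a x. \<lbrakk>a \<in> carrier R; x \<in> carrier A\<rbrakk> \<Longrightarrow> d (a \<odot>\<^bsub>A\<^esub> x) = a \<odot>\<^bsub>B\<^esub> d x"
    and "\<And>x y. \<lbrakk>x \<in> carrier A; y \<in> carrier A\<rbrakk> \<Longrightarrow>
      d (lbracket A x y) = lbracket B (d x) (\<phi> y) \<oplus>\<^bsub>B\<^esub> lbracket B (\<phi> x) (d y)"
  shows "d \<in> lie_derivation R A B \<phi>"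
  using assms by (simp add: lie_derivation_def)

lemma lie_derivationD:
  assumes "d \<in> lie_derivation R A B \<phi>"
  shows "x \<in> carrier A \<Longrightarrow> d x \<in> carrier B"
    and "\<lbrakk>x \<in> carrier A; y \<in> carrier A\<rbrakk> \<Longrightarrow> d (x \<oplus>\<^bsub>A\<^esub> y) = d x \<oplus>\<^bsub>B\<^esub> d y"
    and "\<lbrakk>a \<in> carrier R; x \<in> carrier A\<rbrakk> \<Longrightarrow> d (a \<odot>\<^bsub>A\<^esub> x) = a \<odot>\<^bsub>B\<^esub> d x"
    and "\<lbrakk>x \<in> carrier A; y \<in> carrier A\<rbrakk> \<Longrightarrow>
      d (lbracket A x y) = lbracket B (d x) (\<phi> y) \<oplus>\<^bsub>B\<^esub> lbracket B (\<phi> x) (d y)"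
  using assms by (auto simp: lie_derivation_def)

lemma lie_derivation_zero_minus:
  assumes "lie_algebra R A" "lie_algebra R B" "d \<in> lie_derivation R A B \<phi>"
  shows "d \<zero>\<^bsub>A\<^esub> = \<zero>\<^bsub>B\<^esub>"
    and "x \<in> carrier A \<Longrightarrow> d (\<ominus>\<^bsub>A\<^esub> x) = \<ominus>\<^bsub>B\<^esub> d x"
    and "\<lbrakk>x \<in> carrier A; y \<in> carrier A\<rbrakk> \<Longrightarrow> d (x \<ominus>\<^bsub>A\<^esub> y) = d x \<ominus>\<^bsub>B\<^esub> d y"
proof -
  note m = linear_map_zero_minus[OF lie_algebra.axioms(1)[OF assms(1)] lie_algebra.axioms(1)[OF assms(2)],
      OF lie_derivationD(1,3)[OF assms(3)]]
  interpret A: lie_algebra R A by fact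
  show "d \<zero>\<^bsub>A\<^esub> = \<zero>\<^bsub>B\<^esub>" by (rule m)
  show "x \<in> carrier A \<Longrightarrow> d (\<ominus>\<^bsub>A\<^esub> x) = \<ominus>\<^bsub>B\<^esub> d x" by (rule m)
  then show "\<lbrakk>x \<in> carrier A; y \<in> carrier A\<rbrakk> \<Longrightarrow> d (x \<ominus>\<^bsub>A\<^esub> y) = d x \<ominus>\<^bsub>B\<^esub> d y"
    using m(2)[of y] by (simp add: a_minus_def lie_derivationD(2)[OF assms(3)])
qed

text \<open>The Leibniz rule computes the value at a bracket from the values at its factors and from
  \<phi>, which both derivations share.\<close>

lemma lie_derivation_eq_on_span:
  assumes "lie_algebra R A" "lie_algebra R B"
    and "d \<in> lie_derivation R A B \<phi>" "e \<in> lie_derivation R A B \<phi>"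
    and "G \<subseteq> carrier A" "\<And>x. x \<in> G \<Longrightarrow> d x = e x" "x \<in> lie_span R A G"
  shows "d x = e x"
proof -
  note closed = lie_span_closed[OF assms(1,5)]
  from assms(7) show ?thesis
    by induction (use closed in \<open>auto simp: lie_derivationD[OF assms(3)] lie_derivationD[OF assms(4)]
        lie_derivation_zero_minus[OF assms(1-3)] lie_derivation_zero_minus[OF assms(1,2,4)] assms(6)\<close>)
qed

text \<open>With \<open>lie_derivation_comp_hom\<close> this makes the two sides of an equivariance
  equation \<open>f (d x) = d' (f x)\<close> derivations along the same \<open>f\<close>.\<close>

lemma hom_comp_lie_derivation:
  assumes "lie_algebra R A" "d \<in> lie_derivation R A A (\<lambda>x. x)" "f \<in> lie_hom R A B"
  shows "(\<lambda>x. f (d x)) \<in> lie_derivation R A B f"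
  using lie_derivationD[OF assms(2)] lie_homD[OF assms(3)] lie_algebra.lbracket_closed[OF assms(1)]
  by (intro lie_derivationI) simp_all

lemma lie_derivation_comp_hom:
  assumes "f \<in> lie_hom R A B" "d \<in> lie_derivation R B B (\<lambda>x. x)"
  shows "(\<lambda>x. d (f x)) \<in> lie_derivation R A B f"
  using lie_derivationD[OF assms(2)] lie_homD[OF assms(1)]
  by (intro lie_derivationI) simp_all

lemma ad_derivation:
  assumes "lie_algebra R A" "x \<in> carrier A"
  shows "lbracket A x \<in> lie_derivation R A A (\<lambda>x. x)"
proof -
  interpret A: lie_algebra R A by fact
  show ?thesis
    using assms(2) by (intro lie_derivationI) (simp_all add: A.lie_simps A.jacobi_right[of x])
qed

text \<open>This and the next two closure properties treat the right-hand sides of the action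
  axioms: additivity, homogeneity and the bracket rule in the acting element.\<close>

lemma lie_derivation_add:
  assumes "lie_algebra R A"
    and d: "d \<in> lie_derivation R A A (\<lambda>x. x)" and e: "e \<in> lie_derivation R A A (\<lambda>x. x)"
  shows "(\<lambda>x. d x \<oplus>\<^bsub>A\<^esub> e x) \<in> lie_derivation R A A (\<lambda>x. x)"
proof -
  interpret A: lie_algebra R A by fact
  show ?thesis
    by (intro lie_derivationI)
      (simp_all add: lie_derivationD[OF d] lie_derivationD[OF e] A.lie_simps A.smult_r_distr A.M.a_ac)
qed

lemma lie_derivation_smult:
  assumes "lie_algebra R A"
    and d: "d \<in> lie_derivation R A A (\<lambda>x. x)" and a: "a \<in> carrier R"
  shows "(\<lambda>x. a \<odot>\<^bsub>A\<^esub> d x) \<in> lie_derivation R A A (\<lambda>x. x)"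
proof -
  interpret A: lie_algebra R A by fact
  show ?thesis
  proof (intro lie_derivationI)
    \<comment> \<open>Homogeneity asks to exchange the scalars \<open>a\<close> and
      \<open>b\<close>, which is commutativity of \<open>R\<close>.\<close>
    fix b x assume "b \<in> carrier R" "x \<in> carrier A"
    then show "a \<odot>\<^bsub>A\<^esub> d (b \<odot>\<^bsub>A\<^esub> x) = b \<odot>\<^bsub>A\<^esub> (a \<odot>\<^bsub>A\<^esub> d x)"
      using a by (simp add: lie_derivationD[OF d] A.smult_assoc1[symmetric] A.R.m_comm)
  qed (use a in \<open>simp_all add: lie_derivationD[OF d] A.lie_simps A.smult_r_distr\<close>)
qed

text \<open>For the commutator of derivations: \<open>q\<close> and \<open>r\<close> stand for the
  mixed terms \<open>[e x, d y]\<close> and \<open>[d x, e y]\<close>, which occur in both orders of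
  composition and cancel.\<close>

lemma (in abelian_group) add_minus_add_cancel:
  assumes "p \<in> carrier G" "q \<in> carrier G" "r \<in> carrier G" "s \<in> carrier G"
    "p' \<in> carrier G" "s' \<in> carrier G"
  shows "((p \<oplus> q) \<oplus> (r \<oplus> s)) \<ominus> ((p' \<oplus> r) \<oplus> (q \<oplus> s')) = (p \<ominus> p') \<oplus> (s \<ominus> s')"
proof -
  have "((p \<oplus> q) \<oplus> (r \<oplus> s)) \<ominus> ((p' \<oplus> r) \<oplus> (q \<oplus> s')) =
      ((p \<ominus> p') \<oplus> (s \<ominus> s')) \<oplus> ((q \<ominus> q) \<oplus> (r \<ominus> r))"
    using assms by (simp add: a_minus_def minus_add a_ac)
  then show ?thesis
    using assms by (simp add: a_minus_def r_neg)
qed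

lemma lie_derivation_commutator:
  assumes "lie_algebra R A"
    and d: "d \<in> lie_derivation R A A (\<lambda>x. x)" and e: "e \<in> lie_derivation R A A (\<lambda>x. x)"
  shows "(\<lambda>x. d (e x) \<ominus>\<^bsub>A\<^esub> e (d x)) \<in> lie_derivation R A A (\<lambda>x. x)"
proof -
  interpret A: lie_algebra R A by fact
  show ?thesis
  proof (intro lie_derivationI)
    fix x y assume xy: "x \<in> carrier A" "y \<in> carrier A"
    have "d (e (lbracket A x y)) \<ominus>\<^bsub>A\<^esub> e (d (lbracket A x y)) =
      ((lbracket A (d (e x)) y \<oplus>\<^bsub>A\<^esub> lbracket A (e x) (d y)) \<oplus>\<^bsub>A\<^esub>
        (lbracket A (d x) (e y) \<oplus>\<^bsub>A\<^esub> lbracket A x (d (e y)))) \<ominus>\<^bsub>A\<^esub>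
      ((lbracket A (e (d x)) y \<oplus>\<^bsub>A\<^esub> lbracket A (d x) (e y)) \<oplus>\<^bsub>A\<^esub>
        (lbracket A (e x) (d y) \<oplus>\<^bsub>A\<^esub> lbracket A x (e (d y))))"
      using xy by (simp add: lie_derivationD[OF d] lie_derivationD[OF e] A.lbracket_closed)
    also have "\<dots> = (lbracket A (d (e x)) y \<ominus>\<^bsub>A\<^esub> lbracket A (e (d x)) y) \<oplus>\<^bsub>A\<^esub>
        (lbracket A x (d (e y)) \<ominus>\<^bsub>A\<^esub> lbracket A x (e (d y)))"
      using xy by (intro A.M.add_minus_add_cancel)
        (simp_all add: lie_derivationD(1)[OF d] lie_derivationD(1)[OF e] A.lbracket_closed)
    finally show "d (e (lbracket A x y)) \<ominus>\<^bsub>A\<^esub> e (d (lbracket A x y)) =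
        lbracket A (d (e x) \<ominus>\<^bsub>A\<^esub> e (d x)) y \<oplus>\<^bsub>A\<^esub> lbracket A x (d (e y) \<ominus>\<^bsub>A\<^esub> e (d y))"
      using xy by (simp add: lie_derivationD(1)[OF d] lie_derivationD(1)[OF e] a_minus_def
          A.lie_simps A.lbracket_minus_left A.lbracket_minus_right)
  qed (simp_all add: lie_derivationD[OF d] lie_derivationD[OF e] A.smult_r_distr A.smult_r_minus
      a_minus_def A.M.minus_add A.M.a_ac)
qed

text \<open>The extension of scalars of \<open>A\<close> to the dual numbers
  \<open>R[\<epsilon>]\<close> with \<open>\<epsilon>^2 = 0\<close>; the pair \<open>(x, u)\<close>
  stands for \<open>x + \<epsilon> u\<close>.\<close>

definition lie_tangent :: "('r, 'a) lie_algebra \<Rightarrow> ('r, 'a \<times> 'a) lie_algebra"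
  where "lie_tangent A = \<lparr>carrier = carrier A \<times> carrier A, mult = undefined, one = undefined,
    zero = (\<zero>\<^bsub>A\<^esub>, \<zero>\<^bsub>A\<^esub>),
    add = (\<lambda>X Y. (fst X \<oplus>\<^bsub>A\<^esub> fst Y, snd X \<oplus>\<^bsub>A\<^esub> snd Y)),
    smult = (\<lambda>a X. (a \<odot>\<^bsub>A\<^esub> fst X, a \<odot>\<^bsub>A\<^esub> snd X)),
    lbracket = (\<lambda>X Y. (lbracket A (fst X) (fst Y),
      lbracket A (snd X) (fst Y) \<oplus>\<^bsub>A\<^esub> lbracket A (fst X) (snd Y)))\<rparr>"

lemma lie_tangent_simps [simp]:
  "carrier (lie_tangent A) = carrier A \<times> carrier A"
  "\<zero>\<^bsub>lie_tangent A\<^esub> = (\<zero>\<^bsub>A\<^esub>, \<zero>\<^bsub>A\<^esub>)"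
  "(x, u) \<oplus>\<^bsub>lie_tangent A\<^esub> (y, v) = (x \<oplus>\<^bsub>A\<^esub> y, u \<oplus>\<^bsub>A\<^esub> v)"
  "a \<odot>\<^bsub>lie_tangent A\<^esub> (x, u) = (a \<odot>\<^bsub>A\<^esub> x, a \<odot>\<^bsub>A\<^esub> u)"
  "lbracket (lie_tangent A) (x, u) (y, v) = (lbracket A x y, lbracket A u y \<oplus>\<^bsub>A\<^esub> lbracket A x v)"
  by (simp_all add: lie_tangent_def)

lemma lie_tangent_lie_algebra:
  assumes "lie_algebra R A"
  shows "lie_algebra R (lie_tangent A)"
proof -
  interpret A: lie_algebra R A by fact
  have "abelian_group (lie_tangent A)"
  proof (rule abelian_groupI)
    fix x assume "x \<in> carrier (lie_tangent A)"
    then show "\<exists>y\<in>carrier (lie_tangent A). y \<oplus>\<^bsub>lie_tangent A\<^esub> x = \<zero>\<^bsub>lie_tangent A\<^esub>"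
      by (intro bexI[of _ "(\<ominus>\<^bsub>A\<^esub> fst x, \<ominus>\<^bsub>A\<^esub> snd x)"]) (auto simp: A.M.l_neg)
  qed (auto simp: A.M.a_assoc intro: A.M.a_comm)
  then have "module R (lie_tangent A)"
    by (intro moduleI A.R.cring_axioms)
      (auto simp: A.smult_l_distr A.smult_r_distr A.smult_assoc1)
  then show ?thesis
  proof (intro lie_algebra.intro lie_algebra_axioms.intro)
    fix x y z
    assume "x \<in> carrier (lie_tangent A)" "y \<in> carrier (lie_tangent A)" "z \<in> carrier (lie_tangent A)"
    then obtain x1 x2 y1 y2 z1 z2
      where eq: "x = (x1, x2)" "y = (y1, y2)" "z = (z1, z2)"
        and c: "x1 \<in> carrier A" "x2 \<in> carrier A" "y1 \<in> carrier A" "y2 \<in> carrier A"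
          "z1 \<in> carrier A" "z2 \<in> carrier A"
      by auto
    define J where "J = (\<lambda>x y z. lbracket A x (lbracket A y z) \<oplus>\<^bsub>A\<^esub>
      (lbracket A y (lbracket A z x) \<oplus>\<^bsub>A\<^esub> lbracket A z (lbracket A x y)))"
    have J: "J x y z = \<zero>\<^bsub>A\<^esub>" if "x \<in> carrier A" "y \<in> carrier A" "z \<in> carrier A" for x y z
      using A.jacobi[OF that] by (simp add: J_def)
    \<comment> \<open>The Jacobi sum \<open>J\<close> is trilinear, so its \<epsilon>-coefficient is
      the sum of the three values in which exactly one argument is replaced by its
      \<epsilon>-part.\<close>
    have "snd (lbracket (lie_tangent A) x (lbracket (lie_tangent A) y z) \<oplus>\<^bsub>lie_tangent A\<^esub>
        (lbracket (lie_tangent A) y (lbracket (lie_tangent A) z x) \<oplus>\<^bsub>lie_tangent A\<^esub>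
          lbracket (lie_tangent A) z (lbracket (lie_tangent A) x y))) =
        J x2 y1 z1 \<oplus>\<^bsub>A\<^esub> (J x1 y2 z1 \<oplus>\<^bsub>A\<^esub> J x1 y1 z2)"
      using c by (simp add: eq J_def A.lie_simps A.M.a_ac)
    then show "lbracket (lie_tangent A) x (lbracket (lie_tangent A) y z) \<oplus>\<^bsub>lie_tangent A\<^esub>
        (lbracket (lie_tangent A) y (lbracket (lie_tangent A) z x) \<oplus>\<^bsub>lie_tangent A\<^esub>
          lbracket (lie_tangent A) z (lbracket (lie_tangent A) x y)) = \<zero>\<^bsub>lie_tangent A\<^esub>"
      using c A.jacobi by (simp add: eq J)
  qed (auto simp: A.lie_simps A.smult_r_distr A.M.a_ac A.lbracket_anticomm)
qed

section \<open>Uniqueness and extension of maps out of the coproduct\<close>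

lemma lie_coprod_span:
  assumes "x \<in> carrier (lie_coprod R M N)"
  shows "x \<in> lie_span R (lie_coprod R M N)
    (coprod_inl R M N ` carrier M \<union> coprod_inr R M N ` carrier N)"
proof -
  obtain t where t: "t \<in> lie_terms R M N" "x = lie_term_class R M N t"
    using assms by (auto simp: lie_coprod_carrier)
  from t(1) have "lie_term_class R M N t \<in> lie_span R (lie_coprod R M N)
    (coprod_inl R M N ` carrier M \<union> coprod_inr R M N ` carrier N)"
  proof induction
    case 3
    then show ?case by (metis lie_span.zero lie_coprod_zero)
  next
    case (4 s t)
    then show ?case by (metis lie_span.add lie_coprod_add)
  next
    case (5 a t)
    then show ?case by (metis lie_span.smult lie_coprod_smult)
  next
    case (6 s t)
    then show ?case by (metis lie_span.bracket lie_coprod_bracket)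
  qed (auto simp: coprod_inl_def coprod_inr_def intro: lie_span.gen)
  with t show ?thesis by simp
qed

lemma lie_coprod_gens_subset:
  "coprod_inl R M N ` carrier M \<union> coprod_inr R M N ` carrier N \<subseteq> carrier (lie_coprod R M N)"
  by (auto simp: lie_homD(1)[OF coprod_inl_hom] lie_homD(1)[OF coprod_inr_hom])

lemma lie_coprod_hom_eq:
  assumes "lie_algebra R Z"
    and "h \<in> lie_hom R (lie_coprod R M N) Z" "k \<in> lie_hom R (lie_coprod R M N) Z"
    and "\<And>m. m \<in> carrier M \<Longrightarrow> h (coprod_inl R M N m) = k (coprod_inl R M N m)"
    and "\<And>n. n \<in> carrier N \<Longrightarrow> h (coprod_inr R M N n) = k (coprod_inr R M N n)"
    and "x \<in> carrier (lie_coprod R M N)"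
  shows "h x = k x"
proof (rule lie_hom_eq_on_span[OF lie_coprod_lie_algebra assms(1-3) lie_coprod_gens_subset _
      lie_coprod_span[OF assms(6)]])
  interpret Z: lie_algebra R Z by fact
  show "cring R" by (rule Z.R.cring_axioms)
qed (use assms(4,5) in auto)

lemma lie_coprod_derivation_eq:
  assumes "lie_algebra R Z"
    and "d \<in> lie_derivation R (lie_coprod R M N) Z \<phi>" "e \<in> lie_derivation R (lie_coprod R M N) Z \<phi>"
    and "\<And>m. m \<in> carrier M \<Longrightarrow> d (coprod_inl R M N m) = e (coprod_inl R M N m)"
    and "\<And>n. n \<in> carrier N \<Longrightarrow> d (coprod_inr R M N n) = e (coprod_inr R M N n)"
    and "x \<in> carrier (lie_coprod R M N)"
  shows "d x = e x"
proof (rule lie_derivation_eq_on_span[OF lie_coprod_lie_algebra assms(1-3) lie_coprod_gens_subset _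
      lie_coprod_span[OF assms(6)]])
  interpret Z: lie_algebra R Z by fact
  show "cring R" by (rule Z.R.cring_axioms)
qed (use assms(4,5) in auto)

text \<open>
  A derivation \<open>d\<close> along \<open>\<phi>\<close> is the same as a morphism \<open>x \<mapsto> \<phi> x + \<epsilon> (d x)\<close> into the tangent
  algebra, so that the universal property of the coproduct applies to derivations.
\<close>

lemma lie_coprod_derivation_extend:
  assumes "lie_algebra R Z" "\<phi> \<in> lie_hom R (lie_coprod R M N) Z"
    and d: "d \<in> lie_derivation R M Z (\<lambda>m. \<phi> (coprod_inl R M N m))"
    and e: "e \<in> lie_derivation R N Z (\<lambda>n. \<phi> (coprod_inr R M N n))"
  obtains D where "D \<in> lie_derivation R (lie_coprod R M N) Z \<phi>"
    and "\<And>m. m \<in> carrier M \<Longrightarrow> D (coprod_inl R M N m) = d m"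
    and "\<And>n. n \<in> carrier N \<Longrightarrow> D (coprod_inr R M N n) = e n"
proof -
  let ?S = "lie_coprod R M N" and ?T = "lie_tangent Z"
  interpret Z: lie_algebra R Z by fact
  interpret S: lie_algebra R ?S by (rule lie_coprod_lie_algebra) (rule Z.R.cring_axioms)
  have T: "lie_algebra R ?T" by (rule lie_tangent_lie_algebra[OF assms(1)])
  have f: "(\<lambda>m. (\<phi> (coprod_inl R M N m), d m)) \<in> lie_hom R M ?T"
    by (intro lie_homI) (simp_all add: lie_homD[OF assms(2)] lie_homD[OF coprod_inl_hom]
        lie_derivationD[OF d])
  have g: "(\<lambda>n. (\<phi> (coprod_inr R M N n), e n)) \<in> lie_hom R N ?T"
    by (intro lie_homI) (simp_all add: lie_homD[OF assms(2)] lie_homD[OF coprod_inr_hom]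
        lie_derivationD[OF e])
  obtain h where h: "h \<in> lie_hom R ?S ?T"
    and hl: "\<And>m. m \<in> carrier M \<Longrightarrow> h (coprod_inl R M N m) = (\<phi> (coprod_inl R M N m), d m)"
    and hr: "\<And>n. n \<in> carrier N \<Longrightarrow> h (coprod_inr R M N n) = (\<phi> (coprod_inr R M N n), e n)"
    using lie_coprod_universal[OF T f g] by blast
  have "fst \<in> lie_hom R ?T Z"
    by (intro lie_homI) auto
  from lie_hom_comp[OF h this] have fst: "(\<lambda>x. fst (h x)) \<in> lie_hom R ?S Z" .
  \<comment> \<open>The first component of \<open>h\<close> is a morphism with the values of \<phi>
    on the generators, hence equals \<phi>. The bracket of the tangent algebra then turns
    multiplicativity of \<open>h\<close> into the Leibniz rule for its second component.\<close>
  have hx: "h x = (\<phi> x, snd (h x))" if "x \<in> carrier ?S" for x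
    using lie_coprod_hom_eq[OF assms(1) fst assms(2) _ _ that]
    by (metis hl hr fst_conv prod.collapse)
  have "snd (h x) \<in> carrier Z" if "x \<in> carrier ?S" for x
    using lie_homD(1)[OF h that] by auto
  moreover have "snd (h (x \<oplus>\<^bsub>?S\<^esub> y)) = snd (h x) \<oplus>\<^bsub>Z\<^esub> snd (h y)"
    "snd (h (lbracket ?S x y)) = lbracket Z (snd (h x)) (\<phi> y) \<oplus>\<^bsub>Z\<^esub> lbracket Z (\<phi> x) (snd (h y))"
    if "x \<in> carrier ?S" "y \<in> carrier ?S" for x y
    using hx[OF that(1)] hx[OF that(2)] lie_homD(2,4)[OF h that]
    by (metis lie_tangent_simps(3) snd_conv, metis lie_tangent_simps(5) snd_conv)
  moreover have "snd (h (a \<odot>\<^bsub>?S\<^esub> x)) = a \<odot>\<^bsub>Z\<^esub> snd (h x)"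
    if "a \<in> carrier R" "x \<in> carrier ?S" for a x
    using hx[OF that(2)] lie_homD(3)[OF h that] by (metis lie_tangent_simps(4) snd_conv)
  ultimately have "(\<lambda>x. snd (h x)) \<in> lie_derivation R ?S Z \<phi>"
    by (intro lie_derivationI) simp_all
  then show ?thesis
    by (rule that) (simp_all add: hl hr)
qed

section \<open>Actions\<close>

text \<open>Collects the conditions on the second argument into one membership, so that uniqueness
  of derivations applies to each acting element.\<close>

lemma lie_action_iff:
  "lie_action R P A \<psi> \<longleftrightarrow> (\<forall>p\<in>carrier P. \<psi> p \<in> lie_derivation R A A (\<lambda>x. x)) \<and>
    (\<forall>p\<in>carrier P. \<forall>p'\<in>carrier P. \<forall>x\<in>carrier A. \<psi> (p \<oplus>\<^bsub>P\<^esub> p') x = \<psi> p x \<oplus>\<^bsub>A\<^esub> \<psi> p' x) \<and>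
    (\<forall>a\<in>carrier R. \<forall>p\<in>carrier P. \<forall>x\<in>carrier A. \<psi> (a \<odot>\<^bsub>P\<^esub> p) x = a \<odot>\<^bsub>A\<^esub> \<psi> p x) \<and>
    (\<forall>p\<in>carrier P. \<forall>p'\<in>carrier P. \<forall>x\<in>carrier A.
      \<psi> (lbracket P p p') x = \<psi> p (\<psi> p' x) \<ominus>\<^bsub>A\<^esub> \<psi> p' (\<psi> p x))"
  unfolding lie_action_def lie_derivation_def by auto

lemma lie_actionD:
  assumes "lie_action R P A \<psi>" "p \<in> carrier P"
  shows "\<psi> p \<in> lie_derivation R A A (\<lambda>x. x)"
    and "x \<in> carrier A \<Longrightarrow> \<psi> p x \<in> carrier A"
    and "\<lbrakk>p' \<in> carrier P; x \<in> carrier A\<rbrakk> \<Longrightarrow> \<psi> (p \<oplus>\<^bsub>P\<^esub> p') x = \<psi> p x \<oplus>\<^bsub>A\<^esub> \<psi> p' x"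
    and "\<lbrakk>a \<in> carrier R; x \<in> carrier A\<rbrakk> \<Longrightarrow> \<psi> (a \<odot>\<^bsub>P\<^esub> p) x = a \<odot>\<^bsub>A\<^esub> \<psi> p x"
    and "\<lbrakk>p' \<in> carrier P; x \<in> carrier A\<rbrakk> \<Longrightarrow>
      \<psi> (lbracket P p p') x = \<psi> p (\<psi> p' x) \<ominus>\<^bsub>A\<^esub> \<psi> p' (\<psi> p x)"
  using assms unfolding lie_action_iff by (auto dest: lie_derivationD(1))

lemma coprod_action:
  assumes "lie_algebra R L"
    and a: "lie_action R L M \<psi>\<^sub>M" and b: "lie_action R L N \<psi>\<^sub>N"
    and "lie_algebra R M" "lie_algebra R N"
  defines "\<Psi> \<equiv> coprod_action R L M N \<psi>\<^sub>M \<psi>\<^sub>N"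
  shows "lie_action R L (lie_coprod R M N) \<Psi>"
    and "\<lbrakk>l \<in> carrier L; m \<in> carrier M\<rbrakk> \<Longrightarrow> \<Psi> l (coprod_inl R M N m) = coprod_inl R M N (\<psi>\<^sub>M l m)"
    and "\<lbrakk>l \<in> carrier L; n \<in> carrier N\<rbrakk> \<Longrightarrow> \<Psi> l (coprod_inr R M N n) = coprod_inr R M N (\<psi>\<^sub>N l n)"
proof -
  let ?S = "lie_coprod R M N"
  let ?P = "\<lambda>\<Psi>. \<Psi> \<in> carrier L \<rightarrow>\<^sub>E (carrier ?S \<rightarrow>\<^sub>E carrier ?S) \<and> lie_action R L ?S \<Psi> \<and>
    (\<forall>l\<in>carrier L. \<forall>m\<in>carrier M. \<Psi> l (coprod_inl R M N m) = coprod_inl R M N (\<psi>\<^sub>M l m)) \<and>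
    (\<forall>l\<in>carrier L. \<forall>n\<in>carrier N. \<Psi> l (coprod_inr R M N n) = coprod_inr R M N (\<psi>\<^sub>N l n))"
  interpret L: lie_algebra R L by fact
  interpret S: lie_algebra R ?S by (rule lie_coprod_lie_algebra) (rule L.R.cring_axioms)
  note S = S.lie_algebra_axioms
  note inl = lie_homD[OF coprod_inl_hom[of R M N]] lie_hom_zero_minus[OF assms(4) S coprod_inl_hom]
  note inr = lie_homD[OF coprod_inr_hom[of R M N]] lie_hom_zero_minus[OF assms(5) S coprod_inr_hom]
  have id: "(\<lambda>x. x) \<in> lie_hom R ?S ?S"
    by (intro lie_homI) simp_all
  have "\<exists>D. D \<in> lie_derivation R ?S ?S (\<lambda>x. x) \<and>
      (\<forall>m\<in>carrier M. D (coprod_inl R M N m) = coprod_inl R M N (\<psi>\<^sub>M l m)) \<and>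
      (\<forall>n\<in>carrier N. D (coprod_inr R M N n) = coprod_inr R M N (\<psi>\<^sub>N l n))" if "l \<in> carrier L" for l
    by (rule lie_coprod_derivation_extend[OF S id
        hom_comp_lie_derivation[OF assms(4) lie_actionD(1)[OF a that] coprod_inl_hom]
        hom_comp_lie_derivation[OF assms(5) lie_actionD(1)[OF b that] coprod_inr_hom]]) blast
  \<comment> \<open>\<open>D l\<close> is chosen separately for each \<open>l\<close>. Its
    dependence on \<open>l\<close> is recovered from uniqueness: both sides of each axiom are
    derivations that agree on the generators.\<close>
  then obtain D where der: "\<And>l. l \<in> carrier L \<Longrightarrow> D l \<in> lie_derivation R ?S ?S (\<lambda>x. x)"
    and Dl: "\<And>l m. \<lbrakk>l \<in> carrier L; m \<in> carrier M\<rbrakk> \<Longrightarrow>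
      D l (coprod_inl R M N m) = coprod_inl R M N (\<psi>\<^sub>M l m)"
    and Dr: "\<And>l n. \<lbrakk>l \<in> carrier L; n \<in> carrier N\<rbrakk> \<Longrightarrow>
      D l (coprod_inr R M N n) = coprod_inr R M N (\<psi>\<^sub>N l n)"
    by metis
  note aD = lie_actionD(2-)[OF a] and bD = lie_actionD(2-)[OF b]
  have add: "D (l \<oplus>\<^bsub>L\<^esub> l') x = D l x \<oplus>\<^bsub>?S\<^esub> D l' x"
    if "l \<in> carrier L" "l' \<in> carrier L" "x \<in> carrier ?S" for l l' x
    by (rule lie_coprod_derivation_eq[OF S der lie_derivation_add[OF S der der] _ _ that(3)])
      (simp_all add: that Dl Dr aD bD inl inr)
  have smult: "D (c \<odot>\<^bsub>L\<^esub> l) x = c \<odot>\<^bsub>?S\<^esub> D l x"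
    if "c \<in> carrier R" "l \<in> carrier L" "x \<in> carrier ?S" for c l x
    by (rule lie_coprod_derivation_eq[OF S der lie_derivation_smult[OF S der] _ _ that(3)])
      (simp_all add: that Dl Dr aD bD inl inr)
  have bracket: "D (lbracket L l l') x = D l (D l' x) \<ominus>\<^bsub>?S\<^esub> D l' (D l x)"
    if "l \<in> carrier L" "l' \<in> carrier L" "x \<in> carrier ?S" for l l' x
    by (rule lie_coprod_derivation_eq[OF S der lie_derivation_commutator[OF S der der] _ _ that(3)])
      (simp_all add: that Dl Dr aD bD inl inr L.lbracket_closed)
  \<comment> \<open>The definite description ranges over extensional functions in both arguments, so
    \<open>D\<close> has to be cut down to the carriers.\<close>
  define E where "E = (\<lambda>l\<in>carrier L. \<lambda>x\<in>carrier ?S. D l x)"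
  have E: "E l x = D l x" if "l \<in> carrier L" "x \<in> carrier ?S" for l x
    using that by (simp add: E_def)
  have derE: "E l \<in> lie_derivation R ?S ?S (\<lambda>x. x)" if "l \<in> carrier L" for l
    using lie_derivationD[OF der[OF that]] that
    by (intro lie_derivationI) (simp_all add: E S.lbracket_closed)
  have "lie_action R L ?S E"
    unfolding lie_action_iff using derE
    by (simp add: E add smult bracket L.lbracket_closed lie_derivationD(1)[OF der])
  then have PE: "?P E"
    by (auto simp: E inl inr Dl Dr) (simp_all add: E_def lie_derivationD(1)[OF der])
  have uniq: "F = E" if F: "?P F" for F
  proof (rule PiE_ext[OF conjunct1[OF F] conjunct1[OF PE]], rule PiE_ext)
    fix l assume l: "l \<in> carrier L"
    show "F l \<in> carrier ?S \<rightarrow>\<^sub>E carrier ?S" "E l \<in> carrier ?S \<rightarrow>\<^sub>E carrier ?S"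
      by (rule PiE_mem[OF conjunct1[OF F] l], rule PiE_mem[OF conjunct1[OF PE] l])
    have der_F: "F l \<in> lie_derivation R ?S ?S (\<lambda>x. x)"
      using F lie_actionD(1)[OF _ l] by blast
    show "F l x = E l x" if "x \<in> carrier ?S" for x
      by (rule lie_coprod_derivation_eq[OF S der_F derE[OF l] _ _ that]) (use F PE l in auto)
  qed
  have "\<Psi> = (THE \<Psi>. ?P \<Psi>)"
    by (simp add: \<Psi>_def coprod_action_def Let_def)
  moreover have "?P (THE \<Psi>. ?P \<Psi>)"
    by (rule theI[where P = ?P, OF PE uniq])
  ultimately have P: "?P \<Psi>"
    by (rule ssubst[where P = ?P])
  show "lie_action R L ?S \<Psi>"
    by (rule conjunct1[OF conjunct2[OF P]])
  show "\<Psi> l (coprod_inl R M N m) = coprod_inl R M N (\<psi>\<^sub>M l m)"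
    if "l \<in> carrier L" "m \<in> carrier M"
    using conjunct1[OF conjunct2[OF conjunct2[OF P]]] that by simp
  show "\<Psi> l (coprod_inr R M N n) = coprod_inr R M N (\<psi>\<^sub>N l n)"
    if "l \<in> carrier L" "n \<in> carrier N"
    using conjunct2[OF conjunct2[OF conjunct2[OF P]]] that by simp
qed

section \<open>Ideals and quotients\<close>

locale lie_algebra_ideal = lie_algebra R A
  for R and A :: "('r, 'a) lie_algebra" (structure) +
  fixes I :: "'a set"
  assumes ideal: "lie_ideal R A I"
begin

lemma submodule_I: "submodule I R A"
  using ideal by (simp add: lie_ideal_def)

text \<open>Makes the coset calculus of additive subgroups available for the ideal.\<close>

sublocale abelian_subgroup I A
  by (intro abelian_subgroupI3 additive_subgroup.intro submodule.axioms(1)[OF submodule_I])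
    (rule M.abelian_group_axioms)

lemma lbracket_ideal_right: "\<lbrakk>x \<in> carrier A; y \<in> I\<rbrakk> \<Longrightarrow> lbracket A x y \<in> I"
  using ideal by (simp add: lie_ideal_def)

lemma lbracket_ideal_left: "\<lbrakk>x \<in> carrier A; y \<in> I\<rbrakk> \<Longrightarrow> lbracket A y x \<in> I"
  using lbracket_swap[of x y] lbracket_ideal_right[of x y] by simp

lemma coset_eq_iff:
  assumes "x \<in> carrier A" "y \<in> carrier A"
  shows "I +> x = I +> y \<longleftrightarrow> x \<ominus> y \<in> I"
proof -
  have "I +> x = I +> y \<longleftrightarrow> x \<in> I +> y"
    using a_repr_independence'[of x y] a_repr_independenceD[of x y] assms by metis
  then show ?thesis
    using a_rcos_module[OF assms(2,1)] by (simp add: a_minus_def)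
qed

text \<open>Scalar multiplication, the bracket and the induced action on a quotient are defined as
  unions over representatives. Such a union collapses when its terms agree, since a coset is
  nonempty.\<close>

lemma UN_coset_eq:
  assumes "x \<in> carrier A" "\<And>y. \<lbrakk>y \<in> carrier A; y \<ominus> x \<in> I\<rbrakk> \<Longrightarrow> F y = F x"
  shows "(\<Union>y\<in>I +> x. F y) = F x"
proof -
  have "F y = F x" if "y \<in> I +> x" for y
    using assms(2)[OF a_elemrcos_carrier[OF assms(1) that]] a_rcos_module_imp[OF assms(1) that]
    by (simp add: a_minus_def)
  moreover have "I +> x \<noteq> {}"
    using a_rcos_self[OF assms(1)] by blast
  ultimately show ?thesis
    by simp
qed

text \<open>If \<open>y\<close> and \<open>x\<close> differ by an element of \<open>I\<close>, then
  \<open>f y \<ominus> f x = f (y \<ominus> x)\<close> lies in \<open>I\<close>. Applied to scalar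
  multiplication, to the bracket in each argument and to an action.\<close>

lemma UN_coset_linear:
  assumes "x \<in> carrier A"
    and "\<And>y. y \<in> carrier A \<Longrightarrow> f y \<in> carrier A" "\<And>y. y \<in> I \<Longrightarrow> f y \<in> I"
    and "\<And>y z. \<lbrakk>y \<in> carrier A; z \<in> carrier A\<rbrakk> \<Longrightarrow> f (y \<ominus> z) = f y \<ominus> f z"
  shows "(\<Union>y\<in>I +> x. I +> f y) = I +> f x"
proof (rule UN_coset_eq[OF assms(1)])
  fix y assume y: "y \<in> carrier A" "y \<ominus> x \<in> I"
  then show "I +> f y = I +> f x"
    using assms(3)[OF y(2)] by (simp add: coset_eq_iff assms(1,2,4))
qed

lemma quotient_carrier: "carrier (lie_quotient A I) = (\<lambda>x. I +> x) ` carrier A"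
  by (auto simp: lie_quotient_def A_RCOSETS_def')

lemma quotient_zero: "\<zero>\<^bsub>lie_quotient A I\<^esub> = I +> \<zero>\<^bsub>A\<^esub>"
  using a_rcos_const[OF zero_closed] by (simp add: lie_quotient_def)

lemma quotient_add:
  "\<lbrakk>x \<in> carrier A; y \<in> carrier A\<rbrakk> \<Longrightarrow> (I +> x) \<oplus>\<^bsub>lie_quotient A I\<^esub> (I +> y) = I +> (x \<oplus> y)"
  by (simp add: lie_quotient_def a_rcos_sum)

lemma quotient_smult:
  assumes "a \<in> carrier R" "x \<in> carrier A"
  shows "a \<odot>\<^bsub>lie_quotient A I\<^esub> (I +> x) = I +> (a \<odot> x)"
  using UN_coset_linear[OF assms(2), of "\<lambda>x. a \<odot> x"] assms submodule.smult_closed[OF submodule_I]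
  by (simp add: lie_quotient_def a_minus_def smult_r_distr smult_r_minus)

lemma quotient_lbracket:
  assumes "x \<in> carrier A" "y \<in> carrier A"
  shows "lbracket (lie_quotient A I) (I +> x) (I +> y) = I +> lbracket A x y"
proof -
  have "(\<Union>y\<in>I +> y. I +> lbracket A x y) = I +> lbracket A x y" if "x \<in> carrier A" for x
    using that assms by (intro UN_coset_linear)
      (simp_all add: lbracket_ideal_right lbracket_closed lbracket_add_right lbracket_minus_right a_minus_def)
  then have "(\<Union>x\<in>I +> x. \<Union>y\<in>I +> y. I +> lbracket A x y) = (\<Union>x\<in>I +> x. I +> lbracket A x y)"
    using a_elemrcos_carrier[OF assms(1)] by simp
  also have "\<dots> = I +> lbracket A x y"
    using assms by (intro UN_coset_linear)
      (simp_all add: lbracket_ideal_left lbracket_closed lbracket_add_left lbracket_minus_left a_minus_def)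
  finally show ?thesis
    by (simp add: lie_quotient_def)
qed

lemmas quotient_simps =
  quotient_carrier quotient_zero quotient_add quotient_smult quotient_lbracket

lemma quotient_lie_algebra: "lie_algebra R (lie_quotient A I)"
proof -
  have "abelian_group (lie_quotient A I)"
  proof (rule abelian_groupI)
    fix X assume "X \<in> carrier (lie_quotient A I)"
    then obtain x where "x \<in> carrier A" "X = I +> x"
      by (auto simp: quotient_carrier)
    then show "\<exists>Y\<in>carrier (lie_quotient A I).
        Y \<oplus>\<^bsub>lie_quotient A I\<^esub> X = \<zero>\<^bsub>lie_quotient A I\<^esub>"
      by (intro bexI[of _ "I +> \<ominus> x"]) (auto simp: quotient_simps M.l_neg)
  qed (auto simp: quotient_simps M.a_ac)
  then have "module R (lie_quotient A I)"
    by (intro moduleI R.cring_axioms)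
      (auto simp: quotient_simps smult_l_distr smult_r_distr smult_assoc1)
  then show ?thesis
    by (intro lie_algebra.intro lie_algebra_axioms.intro)
      (auto simp: quotient_simps lie_simps jacobi)
qed

lemma quotient_map_hom: "(\<lambda>x. I +> x) \<in> lie_hom R A (lie_quotient A I)"
  by (intro lie_homI) (simp_all add: quotient_simps)

lemma quotient_hom_factor:
  assumes "lie_algebra R B" "f \<in> lie_hom R A B" "\<And>x. x \<in> I \<Longrightarrow> f x = \<zero>\<^bsub>B\<^esub>"
  obtains h where "h \<in> lie_hom R (lie_quotient A I) B" "h \<in> extensional (carrier (lie_quotient A I))"
    "\<And>x. x \<in> carrier A \<Longrightarrow> h (I +> x) = f x"
proof -
  interpret B: lie_algebra R B by fact
  \<comment> \<open>\<open>f\<close> is constant on a coset because it kills the differences, so the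
    image of a coset is a singleton and \<open>the_elem\<close> extracts the common value.\<close>
  define h where "h = (\<lambda>X\<in>carrier (lie_quotient A I). the_elem (f ` X))"
  have h: "h (I +> x) = f x" if x: "x \<in> carrier A" for x
  proof -
    have "f y = f x" if "y \<in> I +> x" for y
    proof -
      have y: "y \<in> carrier A" by (rule a_elemrcos_carrier[OF x that])
      have "f y \<ominus>\<^bsub>B\<^esub> f x = \<zero>\<^bsub>B\<^esub>"
        using lie_hom_zero_minus(3)[OF lie_algebra_axioms assms(1,2) y x]
          assms(3)[OF a_rcos_module_imp[OF x that]] by (simp add: a_minus_def)
      then show ?thesis
        using B.M.minus_equality[of "f y" "\<ominus>\<^bsub>B\<^esub> f x"] lie_homD(1)[OF assms(2)] x y
        by (simp add: a_minus_def)
    qed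
    then have "f ` (I +> x) = {f x}"
      using a_rcos_self[OF x] by blast
    then show ?thesis
      using x by (simp add: h_def quotient_carrier)
  qed
  have "h \<in> lie_hom R (lie_quotient A I) B"
    by (intro lie_homI) (auto simp: quotient_simps h lie_homD[OF assms(2)] lbracket_closed)
  then show ?thesis
    by (rule that) (simp add: h_def, rule h)
qed

lemma quotient_action:
  assumes "lie_algebra R P" "lie_action R P A \<psi>" "\<And>p x. \<lbrakk>p \<in> carrier P; x \<in> I\<rbrakk> \<Longrightarrow> \<psi> p x \<in> I"
  shows "\<lbrakk>p \<in> carrier P; x \<in> carrier A\<rbrakk> \<Longrightarrow> (\<Union>y\<in>I +> x. I +> \<psi> p y) = I +> \<psi> p x"
    and "lie_action R P (lie_quotient A I) (\<lambda>p X. \<Union>x\<in>X. I +> \<psi> p x)"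
proof -
  interpret P: lie_algebra R P by fact
  note \<psi> = lie_actionD[OF assms(2)]
  note Q = quotient_lie_algebra
  show act: "(\<Union>y\<in>I +> x. I +> \<psi> p y) = I +> \<psi> p x" if "p \<in> carrier P" "x \<in> carrier A" for p x
    using that assms(3) \<psi>(2) lie_derivation_zero_minus(3)[OF lie_algebra_axioms lie_algebra_axioms \<psi>(1)]
    by (intro UN_coset_linear) simp_all
  define \<Psi> where "\<Psi> = (\<lambda>p X. \<Union>x\<in>X. I +> \<psi> p x)"
  have "\<Psi> p (I +> x) = I +> \<psi> p x" if "p \<in> carrier P" "x \<in> carrier A" for p x
    using act[OF that] by (simp add: \<Psi>_def)
  \<comment> \<open>The bracket axiom contains a difference taken in the quotient; since the
    quotient map is a morphism, that difference is the coset of a difference in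
    \<open>A\<close>.\<close>
  then have "lie_action R P (lie_quotient A I) \<Psi>"
    unfolding lie_action_def
    by (simp add: quotient_simps \<psi>(2-) lie_derivationD(2-)[OF \<psi>(1)] P.lbracket_closed
        lbracket_closed lie_hom_zero_minus(3)[OF lie_algebra_axioms Q quotient_map_hom, symmetric])
  then show "lie_action R P (lie_quotient A I) (\<lambda>p X. \<Union>x\<in>X. I +> \<psi> p x)"
    by (simp only: \<Psi>_def)
qed

end

section \<open>Generated ideals, kernels and stability under derivations\<close>

lemma lie_ideal_gen:
  assumes "lie_algebra R A" "S \<subseteq> carrier A"
  shows "lie_ideal R A (lie_ideal_gen R A S)" and "S \<subseteq> lie_ideal_gen R A S"
    and "\<lbrakk>lie_ideal R A I; S \<subseteq> I\<rbrakk> \<Longrightarrow> lie_ideal_gen R A S \<subseteq> I"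
proof -
  interpret A: lie_algebra R A by fact
  let ?J = "lie_ideal_gen R A S"
  have mem: "x \<in> ?J \<longleftrightarrow> (\<forall>I. lie_ideal R A I \<and> S \<subseteq> I \<longrightarrow> x \<in> I)" for x
    by (auto simp: lie_ideal_gen_def)
  have sub: "submodule I R A" if "lie_ideal R A I" for I
    using that by (simp add: lie_ideal_def)
  \<comment> \<open>The whole carrier belongs to the family being intersected, which keeps the
    intersection inside the algebra.\<close>
  have "lie_ideal R A (carrier A)"
    using A.carrier_is_submodule by (simp add: lie_ideal_def A.lbracket_closed)
  with assms(2) have "?J \<subseteq> carrier A"
    by (auto simp: mem)
  moreover have "\<zero>\<^bsub>A\<^esub> \<in> ?J"
    using subgroup.one_closed[OF submodule.axioms(1)[OF sub]] by (simp add: mem)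
  ultimately have "submodule ?J R A"
    by (intro A.submoduleI)
      (simp_all add: mem A.submoduleE(3)[OF sub] A.submoduleE(4)[OF sub] A.submoduleE(5)[OF sub])
  moreover have "lbracket A x y \<in> ?J" if "x \<in> carrier A" "y \<in> ?J" for x y
    using that by (simp add: mem lie_ideal_def)
  ultimately show "lie_ideal R A ?J"
    by (simp add: lie_ideal_def)
  show "S \<subseteq> ?J"
    by (auto simp: mem)
  show "?J \<subseteq> I" if "lie_ideal R A I" "S \<subseteq> I"
    using that by (auto simp: mem)
qed

lemma lie_ideal_kernel:
  assumes "lie_algebra R A" "lie_algebra R B" "f \<in> lie_hom R A B"
  shows "lie_ideal R A {x \<in> carrier A. f x = \<zero>\<^bsub>B\<^esub>}"
proof -
  interpret A: lie_algebra R A by fact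
  interpret B: lie_algebra R B by fact
  show ?thesis
    unfolding lie_ideal_def
    by (intro conjI A.submoduleI ballI)
      (auto simp: lie_homD[OF assms(3)] lie_hom_zero_minus[OF assms] A.lbracket_closed B.lbracket_zero_right)
qed

text \<open>The elements of the ideal that \<open>d\<close> maps back into it form an ideal: in
  \<open>d [x, y] = [d x, y] + [x, d y]\<close> both terms lie in it as soon as \<open>y\<close> and
  \<open>d y\<close> do. This smaller ideal contains \<open>S\<close>, hence is everything.\<close>

lemma lie_ideal_gen_derivation_closed:
  assumes "lie_algebra R A" "S \<subseteq> carrier A" "d \<in> lie_derivation R A A (\<lambda>x. x)"
    and "\<And>x. x \<in> S \<Longrightarrow> d x \<in> lie_ideal_gen R A S" "x \<in> lie_ideal_gen R A S"
  shows "d x \<in> lie_ideal_gen R A S"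
proof -
  let ?I = "lie_ideal_gen R A S"
  interpret A: lie_algebra_ideal R A ?I
    by (intro lie_algebra_ideal.intro lie_algebra_ideal_axioms.intro assms(1) lie_ideal_gen[OF assms(1,2)])
  have "lie_ideal R A {x \<in> ?I. d x \<in> ?I}"
    unfolding lie_ideal_def
    by (intro conjI A.submoduleI ballI)
      (auto simp: lie_derivationD[OF assms(3)] lie_derivation_zero_minus[OF assms(1,1,3)]
        submodule.smult_closed[OF A.submodule_I] A.lbracket_ideal_right)
  from lie_ideal_gen(3)[OF assms(1,2) this] lie_ideal_gen(2)[OF assms(1,2)] assms(4,5)
  show ?thesis by blast
qed

section \<open>Crossed modules\<close>

lemma crossed_moduleD:
  assumes "crossed_module R L X"
  shows "lie_algebra R L" "lie_algebra R (src X)" "bdry X \<in> lie_hom R (src X) L"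
    "lie_action R L (src X) (act X)"
    and "\<lbrakk>m \<in> carrier (src X); m' \<in> carrier (src X)\<rbrakk> \<Longrightarrow> act X (bdry X m) m' = lbracket (src X) m m'"
    and "\<lbrakk>l \<in> carrier L; m \<in> carrier (src X)\<rbrakk> \<Longrightarrow> bdry X (act X l m) = lbracket L l (bdry X m)"
  using assms by (auto simp: crossed_module_def)

text \<open>
  Both crossed module axioms compare derivations, except that the Peiffer identity
  \<open>\<^bsup>\<partial> x\<^esup> y = [x, y]\<close> is one only in \<open>y\<close>; the \<open>x\<close> that satisfy it for all \<open>y\<close> form a subalgebra
  by the Jacobi identity.
\<close>

lemma crossed_moduleI_span:
  assumes "lie_algebra R L" and A: "lie_algebra R A"
    and f: "f \<in> lie_hom R A L" and \<psi>: "lie_action R L A \<psi>"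
    and G: "G \<subseteq> carrier A" and span: "\<And>x. x \<in> carrier A \<Longrightarrow> x \<in> lie_span R A G"
    and equivariant: "\<And>l x. \<lbrakk>l \<in> carrier L; x \<in> G\<rbrakk> \<Longrightarrow> f (\<psi> l x) = lbracket L l (f x)"
    and peiffer: "\<And>x y. \<lbrakk>x \<in> G; y \<in> G\<rbrakk> \<Longrightarrow> \<psi> (f x) y = lbracket A x y"
  shows "crossed_module R L \<lparr>src = A, bdry = f, act = \<psi>\<rparr>"
proof -
  interpret L: lie_algebra R L by fact
  interpret A: lie_algebra R A by fact
  note fD = lie_homD[OF f] lie_hom_zero_minus[OF A assms(1) f]
  note psiD = lie_actionD[OF \<psi>]
  have "f (\<psi> l x) = lbracket L l (f x)" if "l \<in> carrier L" "x \<in> carrier A" for l x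
    by (rule lie_derivation_eq_on_span[OF A assms(1) hom_comp_lie_derivation[OF A psiD(1) f]
          lie_derivation_comp_hom[OF f ad_derivation] G _ span])
      (use that assms(1) equivariant in auto)
  moreover have "\<psi> (f x) y = lbracket A x y" if "x \<in> carrier A" "y \<in> carrier A" for x y
  proof -
    \<comment> \<open>The second argument stays quantified because the bracket case uses the
      hypothesis for \<open>x\<close> at \<open>[x', y]\<close> and that for \<open>x'\<close> at
      \<open>[x, y]\<close>.\<close>
    have "\<forall>y\<in>carrier A. \<psi> (f x) y = lbracket A x y"
      using span[OF that(1)]
    proof induction
      case (gen x)
      then have x: "x \<in> carrier A" using G by blast
      show ?case
        by (intro ballI, rule lie_derivation_eq_on_span[OF A A psiD(1)[OF fD(1)[OF x]]
              ad_derivation[OF A x] G peiffer[OF gen] span])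
    next
      case zero
      \<comment> \<open>An action is homogeneous in the acting element, so zero acts as zero because
        it is 0 times itself.\<close>
      show ?case
        using psiD(4)[of "\<zero>\<^bsub>L\<^esub>" "\<zero>\<^bsub>R\<^esub>"] by (simp add: fD A.lbracket_zero_left psiD)
    next
      case (add x x')
      then show ?case
        using lie_span_closed[OF A G] by (simp add: fD psiD A.lie_simps)
    next
      case (smult a x)
      then show ?case
        using lie_span_closed[OF A G] by (simp add: fD psiD A.lie_simps)
    next
      case (bracket x x')
      then show ?case
        using lie_span_closed[OF A G]
        by (simp add: fD psiD A.lbracket_closed A.jacobi_left[of x x'])
    qed
    with that show ?thesis by blast
  qed
  ultimately show ?thesis
    using assms by (simp add: crossed_module_def)
qed

section \<open>The Peiffer product\<close>

lemma (in abelian_group) add_minus_add: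
  assumes "a \<in> carrier G" "b \<in> carrier G" "c \<in> carrier G" "d \<in> carrier G"
  shows "(a \<oplus> b) \<ominus> (c \<oplus> d) = (a \<ominus> c) \<oplus> (b \<ominus> d)"
  using assms by (simp add: a_minus_def minus_add a_ac)

text \<open>With \<open>p = l\<close> and \<open>p' = \<nu> n\<close>, equivariance rewrites
  \<open>[l, \<nu> n]\<close> as the image under \<nu> of \<open>l\<close> acting on
  \<open>n\<close>. Hence \<open>L\<close> acts by a Leibniz rule on the induced actions between
  \<open>M\<close> and \<open>N\<close>.\<close>

lemma lie_action_swap:
  assumes "lie_algebra R A" "lie_action R P A \<psi>"
    and "p \<in> carrier P" "p' \<in> carrier P" "x \<in> carrier A"
  shows "\<psi> p (\<psi> p' x) = \<psi> (lbracket P p p') x \<oplus>\<^bsub>A\<^esub> \<psi> p' (\<psi> p x)"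
proof -
  interpret A: lie_algebra R A by fact
  note \<psi> = lie_actionD[OF assms(2)]
  show ?thesis
    using assms(3-5) by (simp add: \<psi> a_minus_def A.M.a_assoc A.M.l_neg)
qed

locale peiffer =
  fixes R :: "('r, 'k) ring_scheme" and M :: "('r, 'm) lie_algebra" and N :: "('r, 'n) lie_algebra"
    and \<alpha> :: "'m \<Rightarrow> 'n \<Rightarrow> 'n" and \<beta> :: "'n \<Rightarrow> 'm \<Rightarrow> 'm"
  assumes M: "lie_algebra R M" and N: "lie_algebra R N"
    and \<alpha>_closed: "\<lbrakk>m \<in> carrier M; n \<in> carrier N\<rbrakk> \<Longrightarrow> \<alpha> m n \<in> carrier N"
    and \<beta>_closed: "\<lbrakk>m \<in> carrier M; n \<in> carrier N\<rbrakk> \<Longrightarrow> \<beta> n m \<in> carrier M"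
begin

abbreviation "S \<equiv> lie_coprod R M N"
abbreviation "i \<equiv> coprod_inl R M N"
abbreviation "j \<equiv> coprod_inr R M N"
abbreviation "K \<equiv> peiffer_ideal R M N \<alpha> \<beta>"
abbreviation "P \<equiv> peiffer_product R M N \<alpha> \<beta>"
abbreviation "q \<equiv> peiffer_quot R M N \<alpha> \<beta>"
abbreviation "l\<^sub>M \<equiv> peiffer_inl R M N \<alpha> \<beta>"
abbreviation "l\<^sub>N \<equiv> peiffer_inr R M N \<alpha> \<beta>"

definition "relators = {i (\<beta> n m) \<ominus>\<^bsub>S\<^esub> lbracket S (j n) (i m) | m n. m \<in> carrier M \<and> n \<in> carrier N} \<union>
  {j (\<alpha> m n) \<ominus>\<^bsub>S\<^esub> lbracket S (i m) (j n) | m n. m \<in> carrier M \<and> n \<in> carrier N}"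

lemma coprod_lie_algebra: "lie_algebra R S"
  by (rule lie_coprod_lie_algebra) (rule module.axioms(1)[OF lie_algebra.axioms(1)[OF M]])

sublocale S: lie_algebra R S
  by (rule coprod_lie_algebra)

lemmas i = lie_homD[OF coprod_inl_hom[of R M N]] lie_hom_zero_minus[OF M coprod_lie_algebra coprod_inl_hom]
lemmas j = lie_homD[OF coprod_inr_hom[of R M N]] lie_hom_zero_minus[OF N coprod_lie_algebra coprod_inr_hom]

lemma peiffer_ideal_eq: "K = lie_ideal_gen R S relators"
  by (simp add: peiffer_ideal_def relators_def Let_def)

lemma relators_subset: "relators \<subseteq> carrier S"
  by (auto simp: relators_def i j \<alpha>_closed \<beta>_closed S.lbracket_closed)

lemma relators_peiffer_ideal:
  assumes "m \<in> carrier M" "n \<in> carrier N"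
  shows "i (\<beta> n m) \<ominus>\<^bsub>S\<^esub> lbracket S (j n) (i m) \<in> K" "j (\<alpha> m n) \<ominus>\<^bsub>S\<^esub> lbracket S (i m) (j n) \<in> K"
proof -
  have "relators \<subseteq> K"
    unfolding peiffer_ideal_eq by (rule lie_ideal_gen(2)[OF coprod_lie_algebra relators_subset])
  then show "i (\<beta> n m) \<ominus>\<^bsub>S\<^esub> lbracket S (j n) (i m) \<in> K" "j (\<alpha> m n) \<ominus>\<^bsub>S\<^esub> lbracket S (i m) (j n) \<in> K"
    using assms unfolding relators_def by blast+
qed

sublocale K: lie_algebra_ideal R S K
  unfolding peiffer_ideal_eq
  by (intro lie_algebra_ideal.intro lie_algebra_ideal_axioms.intro coprod_lie_algebra
      lie_ideal_gen(1)[OF coprod_lie_algebra relators_subset])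

lemma peiffer_lie_algebra: "lie_algebra R P"
  unfolding peiffer_product_def by (rule K.quotient_lie_algebra)

lemma q_hom: "q \<in> lie_hom R S P"
  using K.quotient_map_hom by (simp add: peiffer_product_def peiffer_quot_def[abs_def])

lemma l\<^sub>M_hom: "l\<^sub>M \<in> lie_hom R M P"
  using lie_hom_comp[OF coprod_inl_hom q_hom] by (simp add: peiffer_inl_def comp_def)

lemma l\<^sub>N_hom: "l\<^sub>N \<in> lie_hom R N P"
  using lie_hom_comp[OF coprod_inr_hom q_hom] by (simp add: peiffer_inr_def comp_def)

lemma peiffer_gens_subset: "l\<^sub>M ` carrier M \<union> l\<^sub>N ` carrier N \<subseteq> carrier P"
  by (auto simp: lie_homD(1)[OF l\<^sub>M_hom] lie_homD(1)[OF l\<^sub>N_hom])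

lemma peiffer_span:
  assumes "x \<in> carrier P"
  shows "x \<in> lie_span R P (l\<^sub>M ` carrier M \<union> l\<^sub>N ` carrier N)"
proof -
  obtain s where s: "s \<in> carrier S" "x = q s"
    using assms by (auto simp: peiffer_product_def K.quotient_carrier peiffer_quot_def)
  have "q s \<in> lie_span R P (q ` (i ` carrier M \<union> j ` carrier N))"
    by (rule lie_hom_span[OF coprod_lie_algebra peiffer_lie_algebra q_hom lie_coprod_gens_subset
          lie_coprod_span[OF s(1)]])
  with s(2) show ?thesis
    by (simp add: image_Un image_image peiffer_inl_def peiffer_inr_def)
qed

text \<open>For \<alpha> and \<beta> induced by \<mu> and \<nu>, these equations supply the mixed
  cases of the Peiffer identity.\<close>

lemma q_relators:
  assumes "m \<in> carrier M" "n \<in> carrier N"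
  shows "l\<^sub>M (\<beta> n m) = lbracket P (l\<^sub>N n) (l\<^sub>M m)" "l\<^sub>N (\<alpha> m n) = lbracket P (l\<^sub>M m) (l\<^sub>N n)"
proof -
  have "q (i (\<beta> n m)) = q (lbracket S (j n) (i m))" "q (j (\<alpha> m n)) = q (lbracket S (i m) (j n))"
    using assms relators_peiffer_ideal[OF assms]
    by (simp_all add: peiffer_quot_def K.coset_eq_iff i j \<alpha>_closed \<beta>_closed S.lbracket_closed)
  then show "l\<^sub>M (\<beta> n m) = lbracket P (l\<^sub>N n) (l\<^sub>M m)" "l\<^sub>N (\<alpha> m n) = lbracket P (l\<^sub>M m) (l\<^sub>N n)"
    using assms by (simp_all add: peiffer_inl_def peiffer_inr_def lie_homD(4)[OF q_hom] i j)
qed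

text \<open>The last two hypotheses say that the morphism from \<open>M + N\<close> given by
  \<open>f\<close> and \<open>g\<close> kills the relators. Its kernel is an ideal and therefore
  contains \<open>K\<close>; uniqueness holds because the images of \<open>M\<close> and
  \<open>N\<close> generate \<open>P\<close>.\<close>

lemma peiffer_universal:
  assumes Z: "lie_algebra R Z" and f: "f \<in> lie_hom R M Z" and g: "g \<in> lie_hom R N Z"
    and "\<And>m n. \<lbrakk>m \<in> carrier M; n \<in> carrier N\<rbrakk> \<Longrightarrow> f (\<beta> n m) = lbracket Z (g n) (f m)"
    and "\<And>m n. \<lbrakk>m \<in> carrier M; n \<in> carrier N\<rbrakk> \<Longrightarrow> g (\<alpha> m n) = lbracket Z (f m) (g n)"
  shows "\<exists>!h. h \<in> lie_hom R P Z \<and> h \<in> extensional (carrier P) \<and>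
    (\<forall>m\<in>carrier M. h (l\<^sub>M m) = f m) \<and> (\<forall>n\<in>carrier N. h (l\<^sub>N n) = g n)"
proof -
  interpret Z: lie_algebra R Z by fact
  obtain k where k: "k \<in> lie_hom R S Z" "\<And>m. m \<in> carrier M \<Longrightarrow> k (i m) = f m"
    "\<And>n. n \<in> carrier N \<Longrightarrow> k (j n) = g n"
    using lie_coprod_universal[OF Z f g] by blast
  note kD = lie_homD[OF k(1)] lie_hom_zero_minus[OF coprod_lie_algebra Z k(1)]
  have "k x = \<zero>\<^bsub>Z\<^esub>" if "x \<in> K" for x
  proof -
    have "relators \<subseteq> {x \<in> carrier S. k x = \<zero>\<^bsub>Z\<^esub>}"
      using relators_subset
      by (auto simp: relators_def kD i j k(2,3) assms(4,5) \<alpha>_closed \<beta>_closed S.lbracket_closed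
          Z.lbracket_closed lie_homD(1)[OF f] lie_homD(1)[OF g] a_minus_def Z.M.r_neg)
    from lie_ideal_gen(3)[OF coprod_lie_algebra relators_subset
        lie_ideal_kernel[OF coprod_lie_algebra Z k(1)] this]
    show ?thesis using that by (auto simp: peiffer_ideal_eq)
  qed
  from K.quotient_hom_factor[OF Z k(1) this] obtain h
    where h: "h \<in> lie_hom R P Z" "h \<in> extensional (carrier P)" "\<And>x. x \<in> carrier S \<Longrightarrow> h (q x) = k x"
    unfolding peiffer_product_def peiffer_quot_def by blast
  show ?thesis
  proof (rule ex1I[of _ h])
    show "h \<in> lie_hom R P Z \<and> h \<in> extensional (carrier P) \<and>
        (\<forall>m\<in>carrier M. h (l\<^sub>M m) = f m) \<and> (\<forall>n\<in>carrier N. h (l\<^sub>N n) = g n)"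
      using h k by (simp add: peiffer_inl_def peiffer_inr_def i j)
    fix h' assume h': "h' \<in> lie_hom R P Z \<and> h' \<in> extensional (carrier P) \<and>
        (\<forall>m\<in>carrier M. h' (l\<^sub>M m) = f m) \<and> (\<forall>n\<in>carrier N. h' (l\<^sub>N n) = g n)"
    show "h' = h"
    proof (rule extensionalityI[of _ "carrier P"])
      show "h' x = h x" if "x \<in> carrier P" for x
        by (rule lie_hom_eq_on_span[OF peiffer_lie_algebra Z _ h(1) peiffer_gens_subset _
              peiffer_span[OF that]])
          (use h h' k in \<open>auto simp: peiffer_inl_def peiffer_inr_def i j\<close>)
    qed (use h(2) h' in simp_all)
  qed
qed

end

section \<open>The Peiffer product of two crossed modules over a common codomain\<close>

locale peiffer_xmod =
  fixes R :: "('r, 'k) ring_scheme" and L :: "('r, 'l) lie_algebra"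
    and M :: "('r, 'm) lie_algebra" and N :: "('r, 'n) lie_algebra"
    and \<mu> :: "'m \<Rightarrow> 'l" and \<nu> :: "'n \<Rightarrow> 'l"
    and \<psi>\<^sub>M :: "'l \<Rightarrow> 'm \<Rightarrow> 'm" and \<psi>\<^sub>N :: "'l \<Rightarrow> 'n \<Rightarrow> 'n"
  assumes xmod_M: "crossed_module R L \<lparr>src = M, bdry = \<mu>, act = \<psi>\<^sub>M\<rparr>"
    and xmod_N: "crossed_module R L \<lparr>src = N, bdry = \<nu>, act = \<psi>\<^sub>N\<rparr>"
begin

lemmas MD = crossed_moduleD[OF xmod_M, simplified]
lemmas ND = crossed_moduleD[OF xmod_N, simplified]
lemmas L = MD(1)
lemmas \<psi>\<^sub>M = lie_actionD[OF MD(4)]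
lemmas \<psi>\<^sub>N = lie_actionD[OF ND(4)]
lemmas \<mu> = lie_homD[OF MD(3)]
lemmas \<nu> = lie_homD[OF ND(3)]

sublocale L: lie_algebra R L by (rule L)

sublocale peiffer R M N "\<lambda>m n. \<psi>\<^sub>N (\<mu> m) n" "\<lambda>n m. \<psi>\<^sub>M (\<nu> n) m"
  by (rule peiffer.intro) (simp_all add: MD(2) ND(2) \<psi>\<^sub>M(2) \<psi>\<^sub>N(2) \<mu>(1) \<nu>(1))

abbreviation "\<Psi> \<equiv> coprod_action R L M N \<psi>\<^sub>M \<psi>\<^sub>N"
abbreviation "act\<^sub>P \<equiv> peiffer_action R L M N (\<lambda>m n. \<psi>\<^sub>N (\<mu> m) n) (\<lambda>n m. \<psi>\<^sub>M (\<nu> n) m) \<psi>\<^sub>M \<psi>\<^sub>N"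
abbreviation "bdry\<^sub>P \<equiv> peiffer_copair R L M N (\<lambda>m n. \<psi>\<^sub>N (\<mu> m) n) (\<lambda>n m. \<psi>\<^sub>M (\<nu> n) m) \<mu> \<nu>"

lemmas \<Psi> = coprod_action[OF L MD(4) ND(4) MD(2) ND(2)]

text \<open>
  By equivariance of \<open>\<nu>\<close>, \<open>l\<close> maps the relator of \<open>(n, m)\<close> to the sum of those of \<open>(\<^bsup>l\<^esup>n, m)\<close>
  and \<open>(n, \<^bsup>l\<^esup>m)\<close>.
\<close>

lemma coprod_action_peiffer_ideal:
  assumes l: "l \<in> carrier L" and "x \<in> K"
  shows "\<Psi> l x \<in> K"
proof -
  note d = lie_actionD(1)[OF \<Psi>(1) l]
  note dD = lie_derivationD[OF d] lie_derivation_zero_minus[OF coprod_lie_algebra coprod_lie_algebra d]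
  have relator_M: "\<Psi> l (i (\<psi>\<^sub>M (\<nu> n) m) \<ominus>\<^bsub>S\<^esub> lbracket S (j n) (i m)) \<in> K"
    if m: "m \<in> carrier M" and n: "n \<in> carrier N" for m n
  proof -
    have "\<Psi> l (i (\<psi>\<^sub>M (\<nu> n) m) \<ominus>\<^bsub>S\<^esub> lbracket S (j n) (i m)) =
        (i (\<psi>\<^sub>M (\<nu> (\<psi>\<^sub>N l n)) m) \<oplus>\<^bsub>S\<^esub> i (\<psi>\<^sub>M (\<nu> n) (\<psi>\<^sub>M l m))) \<ominus>\<^bsub>S\<^esub>
        (lbracket S (j (\<psi>\<^sub>N l n)) (i m) \<oplus>\<^bsub>S\<^esub> lbracket S (j n) (i (\<psi>\<^sub>M l m)))"
      using lie_action_swap[OF MD(2,4) l \<nu>(1)[OF n] m] m n l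
      by (simp add: dD i j \<Psi> \<psi>\<^sub>M(2) \<psi>\<^sub>N(2) \<nu> ND(6) S.lbracket_closed L.lbracket_closed)
    also have "\<dots> = (i (\<psi>\<^sub>M (\<nu> (\<psi>\<^sub>N l n)) m) \<ominus>\<^bsub>S\<^esub> lbracket S (j (\<psi>\<^sub>N l n)) (i m)) \<oplus>\<^bsub>S\<^esub>
        (i (\<psi>\<^sub>M (\<nu> n) (\<psi>\<^sub>M l m)) \<ominus>\<^bsub>S\<^esub> lbracket S (j n) (i (\<psi>\<^sub>M l m)))"
      using m n l by (intro S.M.add_minus_add) (simp_all add: i j \<psi>\<^sub>M \<psi>\<^sub>N \<nu> S.lbracket_closed)
    finally show ?thesis
      using m n l by (simp add: relators_peiffer_ideal \<psi>\<^sub>M \<psi>\<^sub>N)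
  qed
  have relator_N: "\<Psi> l (j (\<psi>\<^sub>N (\<mu> m) n) \<ominus>\<^bsub>S\<^esub> lbracket S (i m) (j n)) \<in> K"
    if m: "m \<in> carrier M" and n: "n \<in> carrier N" for m n
  proof -
    have "\<Psi> l (j (\<psi>\<^sub>N (\<mu> m) n) \<ominus>\<^bsub>S\<^esub> lbracket S (i m) (j n)) =
        (j (\<psi>\<^sub>N (\<mu> (\<psi>\<^sub>M l m)) n) \<oplus>\<^bsub>S\<^esub> j (\<psi>\<^sub>N (\<mu> m) (\<psi>\<^sub>N l n))) \<ominus>\<^bsub>S\<^esub>
        (lbracket S (i (\<psi>\<^sub>M l m)) (j n) \<oplus>\<^bsub>S\<^esub> lbracket S (i m) (j (\<psi>\<^sub>N l n)))"
      using lie_action_swap[OF ND(2,4) l \<mu>(1)[OF m] n] m n l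
      by (simp add: dD i j \<Psi> \<psi>\<^sub>M(2) \<psi>\<^sub>N(2) \<mu> MD(6) S.lbracket_closed L.lbracket_closed)
    also have "\<dots> = (j (\<psi>\<^sub>N (\<mu> (\<psi>\<^sub>M l m)) n) \<ominus>\<^bsub>S\<^esub> lbracket S (i (\<psi>\<^sub>M l m)) (j n)) \<oplus>\<^bsub>S\<^esub>
        (j (\<psi>\<^sub>N (\<mu> m) (\<psi>\<^sub>N l n)) \<ominus>\<^bsub>S\<^esub> lbracket S (i m) (j (\<psi>\<^sub>N l n)))"
      using m n l by (intro S.M.add_minus_add) (simp_all add: i j \<psi>\<^sub>M \<psi>\<^sub>N \<mu> S.lbracket_closed)
    finally show ?thesis
      using m n l by (simp add: relators_peiffer_ideal \<psi>\<^sub>M \<psi>\<^sub>N)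
  qed
  have "\<Psi> l x \<in> K" if "x \<in> relators" for x
    using that relator_M relator_N unfolding relators_def by auto
  then show ?thesis
    using lie_ideal_gen_derivation_closed[OF coprod_lie_algebra relators_subset d] \<open>x \<in> K\<close>
    by (simp add: peiffer_ideal_eq)
qed

lemma peiffer_action:
  shows "\<lbrakk>l \<in> carrier L; m \<in> carrier M\<rbrakk> \<Longrightarrow> act\<^sub>P l (l\<^sub>M m) = l\<^sub>M (\<psi>\<^sub>M l m)"
    and "\<lbrakk>l \<in> carrier L; n \<in> carrier N\<rbrakk> \<Longrightarrow> act\<^sub>P l (l\<^sub>N n) = l\<^sub>N (\<psi>\<^sub>N l n)"
    and "lie_action R L P act\<^sub>P"
proof -
  note act = K.quotient_action[OF L \<Psi>(1) coprod_action_peiffer_ideal]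
  show "act\<^sub>P l (l\<^sub>M m) = l\<^sub>M (\<psi>\<^sub>M l m)" if "l \<in> carrier L" "m \<in> carrier M"
    using act(1)[OF _ _ that(1), of "i m"] that
    by (simp add: peiffer_action_def peiffer_inl_def peiffer_quot_def i \<Psi>)
  show "act\<^sub>P l (l\<^sub>N n) = l\<^sub>N (\<psi>\<^sub>N l n)" if "l \<in> carrier L" "n \<in> carrier N"
    using act(1)[OF _ _ that(1), of "j n"] that
    by (simp add: peiffer_action_def peiffer_inr_def peiffer_quot_def j \<Psi>)
  show "lie_action R L P act\<^sub>P"
    using act(2) by (simp add: peiffer_action_def[abs_def] peiffer_quot_def peiffer_product_def)
qed

text \<open>The compatibility required of \<mu> and \<nu> is their equivariance: \<mu> sends the
  action of \<open>\<nu> n\<close> on \<open>m\<close> to \<open>[\<nu> n, \<mu> m]\<close>, and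
  symmetrically for \<nu>.\<close>

lemma peiffer_copair:
  shows "bdry\<^sub>P \<in> lie_hom R P L"
    and "m \<in> carrier M \<Longrightarrow> bdry\<^sub>P (l\<^sub>M m) = \<mu> m"
    and "n \<in> carrier N \<Longrightarrow> bdry\<^sub>P (l\<^sub>N n) = \<nu> n"
proof -
  have "\<exists>!h. h \<in> lie_hom R P L \<and> h \<in> extensional (carrier P) \<and>
      (\<forall>m\<in>carrier M. h (l\<^sub>M m) = \<mu> m) \<and> (\<forall>n\<in>carrier N. h (l\<^sub>N n) = \<nu> n)"
    by (rule peiffer_universal[OF L MD(3) ND(3)]) (simp_all add: MD(6) ND(6) \<mu> \<nu>)
  from theI'[OF this] have *: "bdry\<^sub>P \<in> lie_hom R P L \<and> bdry\<^sub>P \<in> extensional (carrier P) \<and>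
      (\<forall>m\<in>carrier M. bdry\<^sub>P (l\<^sub>M m) = \<mu> m) \<and> (\<forall>n\<in>carrier N. bdry\<^sub>P (l\<^sub>N n) = \<nu> n)"
    unfolding peiffer_copair_def Let_def .
  show "bdry\<^sub>P \<in> lie_hom R P L" "m \<in> carrier M \<Longrightarrow> bdry\<^sub>P (l\<^sub>M m) = \<mu> m"
    "n \<in> carrier N \<Longrightarrow> bdry\<^sub>P (l\<^sub>N n) = \<nu> n"
    using * by auto
qed

lemma peiffer_crossed_module:
  "crossed_module R L \<lparr>src = P, bdry = bdry\<^sub>P, act = act\<^sub>P\<rparr>"
proof (rule crossed_moduleI_span[OF L peiffer_lie_algebra peiffer_copair(1) peiffer_action(3)
      peiffer_gens_subset peiffer_span])
  fix l x assume "l \<in> carrier L" "x \<in> l\<^sub>M ` carrier M \<union> l\<^sub>N ` carrier N"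
  then show "bdry\<^sub>P (act\<^sub>P l x) = lbracket L l (bdry\<^sub>P x)"
    by (auto simp: peiffer_action peiffer_copair MD(6) ND(6) \<psi>\<^sub>M \<psi>\<^sub>N)
next
  \<comment> \<open>Two generators from the same factor satisfy the identity by the Peiffer identity
    of that factor; mixed pairs satisfy it by the relators.\<close>
  fix x y assume "x \<in> l\<^sub>M ` carrier M \<union> l\<^sub>N ` carrier N" "y \<in> l\<^sub>M ` carrier M \<union> l\<^sub>N ` carrier N"
  then show "act\<^sub>P (bdry\<^sub>P x) y = lbracket P x y"
    by (auto simp: peiffer_action peiffer_copair \<mu> \<nu> q_relators MD(5) ND(5)
        lie_homD(4)[OF l\<^sub>M_hom] lie_homD(4)[OF l\<^sub>N_hom])
qed

lemma peiffer_xmod_universal: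
  fixes Z :: "('r, 'l, 'z) xmod"
  assumes Z: "crossed_module R L Z"
    and f: "f \<in> xmod_hom R L \<lparr>src = M, bdry = \<mu>, act = \<psi>\<^sub>M\<rparr> Z"
    and g: "g \<in> xmod_hom R L \<lparr>src = N, bdry = \<nu>, act = \<psi>\<^sub>N\<rparr> Z"
  shows "\<exists>!h. h \<in> xmod_hom R L \<lparr>src = P, bdry = bdry\<^sub>P, act = act\<^sub>P\<rparr> Z \<and>
    h \<in> extensional (carrier P) \<and>
    (\<forall>m\<in>carrier M. h (l\<^sub>M m) = f m) \<and> (\<forall>n\<in>carrier N. h (l\<^sub>N n) = g n)"
proof -
  note ZD = crossed_moduleD[OF Z]
  have f: "f \<in> lie_hom R M (src Z)" "\<And>m. m \<in> carrier M \<Longrightarrow> bdry Z (f m) = \<mu> m"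
    "\<And>l m. \<lbrakk>l \<in> carrier L; m \<in> carrier M\<rbrakk> \<Longrightarrow> f (\<psi>\<^sub>M l m) = act Z l (f m)"
    using f by (auto simp: xmod_hom_def)
  have g: "g \<in> lie_hom R N (src Z)" "\<And>n. n \<in> carrier N \<Longrightarrow> bdry Z (g n) = \<nu> n"
    "\<And>l n. \<lbrakk>l \<in> carrier L; n \<in> carrier N\<rbrakk> \<Longrightarrow> g (\<psi>\<^sub>N l n) = act Z l (g n)"
    using g by (auto simp: xmod_hom_def)
  have ex1: "\<exists>!h. h \<in> lie_hom R P (src Z) \<and> h \<in> extensional (carrier P) \<and>
      (\<forall>m\<in>carrier M. h (l\<^sub>M m) = f m) \<and> (\<forall>n\<in>carrier N. h (l\<^sub>N n) = g n)"
  proof (rule peiffer_universal[OF ZD(2) f(1) g(1)])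
    \<comment> \<open>By equivariance of \<open>f\<close>, the left side is \<open>\<nu> n\<close>
      acting on \<open>f m\<close>. Since \<open>\<nu> n\<close> is the boundary of
      \<open>g n\<close>, the Peiffer identity of \<open>Z\<close> makes it a bracket; the second
      equation is symmetric.\<close>
    fix m n assume "m \<in> carrier M" "n \<in> carrier N"
    then show "f (\<psi>\<^sub>M (\<nu> n) m) = lbracket (src Z) (g n) (f m)"
      "g (\<psi>\<^sub>N (\<mu> m) n) = lbracket (src Z) (f m) (g n)"
      using ZD(5)[of "g n" "f m"] ZD(5)[of "f m" "g n"]
      by (simp_all add: f g \<mu> \<nu> lie_homD(1)[OF f(1)] lie_homD(1)[OF g(1)])
  qed
  \<comment> \<open>A Lie morphism with the prescribed values on generators automatically respects
    boundaries and actions, so existence and uniqueness carry over from Lie algebras to crossed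
    modules.\<close>
  have "h \<in> xmod_hom R L \<lparr>src = P, bdry = bdry\<^sub>P, act = act\<^sub>P\<rparr> Z"
    if h: "h \<in> lie_hom R P (src Z)"
      and hM: "\<And>m. m \<in> carrier M \<Longrightarrow> h (l\<^sub>M m) = f m"
      and hN: "\<And>n. n \<in> carrier N \<Longrightarrow> h (l\<^sub>N n) = g n" for h
  proof -
    have "bdry Z (h x) = bdry\<^sub>P x" if "x \<in> carrier P" for x
      by (rule lie_hom_eq_on_span[OF peiffer_lie_algebra L lie_hom_comp[OF h ZD(3)] peiffer_copair(1)
            peiffer_gens_subset _ peiffer_span[OF that]])
        (auto simp: hM hN f g peiffer_copair)
    moreover have "h (act\<^sub>P l x) = act Z l (h x)" if "l \<in> carrier L" "x \<in> carrier P" for l x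
      by (rule lie_derivation_eq_on_span[OF peiffer_lie_algebra ZD(2)
            hom_comp_lie_derivation[OF peiffer_lie_algebra lie_actionD(1)[OF peiffer_action(3) that(1)] h]
            lie_derivation_comp_hom[OF h lie_actionD(1)[OF ZD(4) that(1)]]
            peiffer_gens_subset _ peiffer_span[OF that(2)]])
        (use that(1) in \<open>auto simp: hM hN f g peiffer_action \<psi>\<^sub>M \<psi>\<^sub>N\<close>)
    ultimately show ?thesis
      using h by (simp add: xmod_hom_def)
  qed
  moreover have "h \<in> lie_hom R P (src Z)"
    if "h \<in> xmod_hom R L \<lparr>src = P, bdry = bdry\<^sub>P, act = act\<^sub>P\<rparr> Z" for h
    using that by (simp add: xmod_hom_def)
  ultimately have "(h \<in> xmod_hom R L \<lparr>src = P, bdry = bdry\<^sub>P, act = act\<^sub>P\<rparr> Z \<and>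
      h \<in> extensional (carrier P) \<and>
      (\<forall>m\<in>carrier M. h (l\<^sub>M m) = f m) \<and> (\<forall>n\<in>carrier N. h (l\<^sub>N n) = g n)) \<longleftrightarrow>
    (h \<in> lie_hom R P (src Z) \<and> h \<in> extensional (carrier P) \<and>
      (\<forall>m\<in>carrier M. h (l\<^sub>M m) = f m) \<and> (\<forall>n\<in>carrier N. h (l\<^sub>N n) = g n))" for h
    by blast
  then show ?thesis
    using ex1 by simp
qed

lemma peiffer_xmod_coproduct:
  "xmod_coproduct TYPE('z) R L
    \<lparr>src = M, bdry = \<mu>, act = \<psi>\<^sub>M\<rparr> \<lparr>src = N, bdry = \<nu>, act = \<psi>\<^sub>N\<rparr>
    \<lparr>src = P, bdry = bdry\<^sub>P, act = act\<^sub>P\<rparr> l\<^sub>M l\<^sub>N"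
proof -
  have "l\<^sub>M \<in> xmod_hom R L \<lparr>src = M, bdry = \<mu>, act = \<psi>\<^sub>M\<rparr> \<lparr>src = P, bdry = bdry\<^sub>P, act = act\<^sub>P\<rparr>"
    by (simp add: xmod_hom_def l\<^sub>M_hom peiffer_copair peiffer_action)
  moreover have "l\<^sub>N \<in> xmod_hom R L \<lparr>src = N, bdry = \<nu>, act = \<psi>\<^sub>N\<rparr> \<lparr>src = P, bdry = bdry\<^sub>P, act = act\<^sub>P\<rparr>"
    by (simp add: xmod_hom_def l\<^sub>N_hom peiffer_copair peiffer_action)
  ultimately show ?thesis
    unfolding xmod_coproduct_def
    by (intro conjI allI impI ballI) (simp_all add: peiffer_crossed_module peiffer_xmod_universal)
qed

end

theorem proposition3p4:
  fixes R :: "('r, 'k) ring_scheme"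
    and L :: "('r, 'l) lie_algebra"
    and M :: "('r, 'm) lie_algebra"
    and N :: "('r, 'n) lie_algebra"
    and \<mu> :: "'m \<Rightarrow> 'l" and \<nu> :: "'n \<Rightarrow> 'l"
    and \<psi>\<^sub>M :: "'l \<Rightarrow> 'm \<Rightarrow> 'm" and \<psi>\<^sub>N :: "'l \<Rightarrow> 'n \<Rightarrow> 'n"
    and \<alpha> :: "'m \<Rightarrow> 'n \<Rightarrow> 'n" and \<beta> :: "'n \<Rightarrow> 'm \<Rightarrow> 'm"
  assumes "cring R" and "lie_algebra R L"
    and "crossed_module R L \<lparr>src = M, bdry = \<mu>, act = \<psi>\<^sub>M\<rparr>"
    and "crossed_module R L \<lparr>src = N, bdry = \<nu>, act = \<psi>\<^sub>N\<rparr>"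
    and "\<alpha> = (\<lambda>m n. \<psi>\<^sub>N (\<mu> m) n)"
    and "\<beta> = (\<lambda>n m. \<psi>\<^sub>M (\<nu> n) m)"
  shows "xmod_coproduct TYPE('z) R L
    \<lparr>src = M, bdry = \<mu>, act = \<psi>\<^sub>M\<rparr>
    \<lparr>src = N, bdry = \<nu>, act = \<psi>\<^sub>N\<rparr>
    \<lparr>src = peiffer_product R M N \<alpha> \<beta>,
     bdry = peiffer_copair R L M N \<alpha> \<beta> \<mu> \<nu>,
     act = peiffer_action R L M N \<alpha> \<beta> \<psi>\<^sub>M \<psi>\<^sub>N\<rparr>
    (peiffer_inl R M N \<alpha> \<beta>) (peiffer_inr R M N \<alpha> \<beta>)"
proof -
  interpret peiffer_xmod R L M N \<mu> \<nu> \<psi>\<^sub>M \<psi>\<^sub>N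
    by (rule peiffer_xmod.intro[OF assms(3,4)])
  show ?thesis
    unfolding assms(5,6) by (rule peiffer_xmod_coproduct)
qed

end
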